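(* Let $A_0=\mathrm{diag}(\lambda_1,\dots,\lambda_n)$ with pairwise distinct $\lambda_i\in\mathbb C$, let $A_1$ be a complex $n\times n$ matrix with diagonal entries $\lambda'_1,\dots,\lambda'_n$ (arbitrary complex numbers), let $\eta$ be admissible and let $c_{jk}=c_{jk}(\eta)$ be the connection coefficients of $(A_0-\lambda)\frac{d\Psi}{d\lambda}=(A_1+I)\Psi$. Let $k$ be such that $\lambda'_k=N_k\in\mathbb N$. Then the vector function $\hat\Psi_k(\lambda)$, $\lambda\in\mathcal P_\eta$, has the following behaviours at $\lambda_j\ne\lambda_k$. For $\lambda'_j\notin\mathbb Z$: $\ \hat\Psi_k(\lambda)=\vec\Psi_j^{[-N_k-1]}(\lambda)\,c_{jk}+\mathrm{reg}(\lambda-\lambda_j)$. For $\lambda'_j=N_j\in\mathbb N$: $$\hat\Psi_k(\lambda)=\begin{cases}\left(\hat\Psi_j^{[N_j-N_k]}(\lambda)\ln(\lambda-\lambda_j)+\dfrac{P^{(j)}_{N_j-N_k-1}(\lambda)}{(\lambda-\lambda_j)^{N_j-N_k}}\right)c_{jk}+\mathrm{reg}(\lambda-\lambda_j),&N_j\ge N_k+1,\\[3mm]\hat\Psi_j^{[-N_k+N_j]}(\lambda)\ln(\lambda-\lambda_j)\,c_{jk}+\mathrm{reg}(\lambda-\lambda_j),&N_k\ge N_j.\end{cases}$$ For $\lambda'_j=N_j\in\mathbb Z_-$: $\ \hat\Psi_k(\lambda)=\vec\Psi_j^{[-N_k-1]}(\lambda)\ln(\lambda-\lambda_j)\,c_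{jk}+\mathrm{reg}(\lambda-\lambda_j)$.
   Context: Systems. (R): $\frac{dY}{dz}=(A_0+A_1/z)Y$. (F): $(A_0-\lambda)\frac{d\Psi}{d\lambda}=(A_1+I)\Psi$. $\mathbb N=\{0,1,2,\dots\}$, $\mathbb Z_-=\{-1,-2,\dots\}$, $\vec e_k$ is the $k$-th unit column vector; $\mathrm{reg}(\lambda-\lambda_j)$ denotes a vector function analytic in a neighbourhood of $\lambda_j$. $B_k=-E_k(A_1+I)$, where $E_k$ has the single nonzero entry $(E_k)_{kk}=1$, is the residue at $\lambda_k$ of (F) written as $\Psi'=\sum_jB_j\Psi/(\lambda-\lambda_j)$. Cuts. $\eta\in\mathbb R$ is admissible if $\eta\neq\arg(\lambda_j-\lambda_k)$ mod $2\pi$ for all $j\ne k$. For admissible $\eta$, $\mathcal P_\eta$ is the plane cut along the rays from each $\lambda_k$ to $\infty$ in direction $\eta$, with the branches $\eta-2\pi<\arg(\lambda-\lambda_k)<\eta$ used for all powers and logarithms of $\lambda-\lambda_k$. Coefficients. With $\Lambda'=\mathrm{diag}(\lambda'_1,\dots,\lambda'_n)$, (R) has a unique formal solution $\bigl(I+\sum_{l\ge1}F_lz^{-l}\bigr)e^{A_0z}z^{\Lambda'}$; $\vec f_l^{(k)}$ is the $k$-th column of $F_l$, and $\vec f_0^{(k)}=\vec e_k$. Solutions $\vec\Psi_k$ of (F) on $\mathcal P_\eta$ (series near $\lambda_k$, continued to $\mathcal P_\eta$): - $\lambda'_k\notin\mathbb Z$: $\vec\Psi_k=\sum_{l\ge0}\Gamma(\lambda'_k+1-l)\vec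 f_l^{(k)}(\lambda-\lambda_k)^{l-\lambda'_k-1}$; - $\lambda'_k=N_k\in\mathbb Z_-$: $\vec\Psi_k=\sum_{l\ge0}\frac{(-1)^{l-N_k}}{(l-N_k-1)!}\vec f_l^{(k)}(\lambda-\lambda_k)^{l-N_k-1}$; - $\lambda'_k=N_k\in\mathbb N$: $\vec\Psi_k=\sum_{l\ge0}\frac{(-1)^{l+1}}{l!}\vec f^{(k)}_{N_k+l+1}(\lambda-\lambda_k)^l$; in this case (F) has a solution of the form $\vec\Psi_k\ln(\lambda-\lambda_k)+\frac{P(\lambda)}{(\lambda-\lambda_k)^{N_k+1}}+\mathrm{reg}(\lambda-\lambda_k)$ with $P(\lambda)=\sum_{l=0}^{N_k}(N_k-l)!\,\vec f_l^{(k)}(\lambda-\lambda_k)^l$. Singular solutions: $\vec\Psi_k^{(sing)}=\vec\Psi_k$ if $\lambda'_k\notin\mathbb Z$; the solution of the form just displayed if $\lambda'_k\in\mathbb N$; if $\lambda'_k=-1$, a solution of the form $\vec\Psi_k\ln(\lambda-\lambda_k)+\mathrm{reg}(\lambda-\lambda_k)$ (for $\lambda'_k=-1$ the matrix $B_k$ is taken to have a nontrivial Jordan block, so that such a solution exists); if $\lambda'_k\in\{-2,-3,\dots\}$, a solution of the form $\vec\Psi_k\ln(\lambda-\lambda_k)+\mathrm{reg}(\lambda-\lambda_k)$ if one exists, and $\vec\Psi_k^{(sing)}\equiv0$ otherwise. Connection coefficients $c_{jk}$ are the unique numbers with $\vec\Psi_k=\vec\Psi_j^{(sing)}c_{jk}+\mathrm{reg}(\lambda-\lambda_j)$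 near $\lambda_j$ in $\mathcal P_\eta$, with $c_{jk}:=0$ for all $k$ when $\lambda'_j\in\{-2,-3,\dots\}$ and $\vec\Psi_j^{(sing)}\equiv0$. $q$-primitives ($q\in\mathbb N$), defined near $\lambda_k$ by convergent series and continued analytically to $\mathcal P_\eta$: - $\lambda'_k\notin\mathbb Z$: $\vec\Psi_k^{[-q]}=(-1)^q\sum_{l\ge q}\Gamma(\lambda'_k+1-l)\vec f^{(k)}_{l-q}(\lambda-\lambda_k)^{l-\lambda'_k-1}$; - $\lambda'_k=N_k\in\mathbb Z_-$: $\vec\Psi_k^{[-q]}=(-1)^q\sum_{l\ge q}\frac{(-1)^{l-N_k}}{(l-N_k-1)!}\vec f^{(k)}_{l-q}(\lambda-\lambda_k)^{l-N_k-1}$; - $\lambda'_k=N_k\in\mathbb N$: $\hat\Psi_k=\sum_{l\ge0}\frac{(-1)^{l+N_k}}{l!}\vec f_l^{(k)}(\lambda-\lambda_k)^l$, $\hat\Psi_k^{[-q]}=(-1)^q\sum_{l\ge q}\frac{(-1)^{l+N_k}}{l!}\vec f^{(k)}_{l-q}(\lambda-\lambda_k)^l$, and for an integer $r\ge0$, $\hat\Psi_k^{[r]}=\frac{d^r}{d\lambda^r}\hat\Psi_k$. For $N_j\ge N_k+1$: $P^{(j)}_{N_j-N_k-1}(\lambda)=(-1)^{N_k+1}\sum_{l=0}^{N_j-N_k-1}(N_j-N_k-1-l)!\,\vec f_l^{(j)}(\lambda-\lambda_j)^l$. *)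

theory Defs
  imports
    "Jordan_Normal_Form.Jordan_Normal_Form"
    "HOL-Complex_Analysis.Complex_Analysis"
begin

no_notation Matrix.vec_index (infixl "$" 100)
hide_const (open) Matrix.mat Matrix.vec Matrix.row Matrix.col

(* The index set {1..n} is an arbitrary nonempty finite type 'n.  Vector functions are complex
   analytic when their components are. *)

definition diagonal_matrix :: "('n::finite \<Rightarrow> complex) \<Rightarrow> complex^'n^'n" where
  "diagonal_matrix d = (\<chi> i j. if i = j then d i else 0)"

definition vec_holomorphic_on :: "(complex \<Rightarrow> complex^'n::finite) \<Rightarrow> complex set \<Rightarrow> bool" where
  "vec_holomorphic_on f S \<longleftrightarrow> (\<forall>i. (\<lambda>z. f z $ i) holomorphic_on S)"

definition vec_analytic_on :: "(complex \<Rightarrow> complex^'n::finite) \<Rightarrow> complex set \<Rightarrow> bool" where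
  "vec_analytic_on f S \<longleftrightarrow> (\<forall>i. (\<lambda>z. f z $ i) analytic_on S)"

definition vec_nderiv :: "nat \<Rightarrow> (complex \<Rightarrow> complex^'n::finite) \<Rightarrow> complex \<Rightarrow> complex^'n" where
  "vec_nderiv r f z = (\<chi> i. (deriv ^^ r) (\<lambda>w. f w $ i) z)"

definition admissible :: "('n::finite \<Rightarrow> complex) \<Rightarrow> real \<Rightarrow> bool" where
  "admissible lam \<eta> \<longleftrightarrow>
     (\<forall>j k. j \<noteq> k \<longrightarrow> (\<forall>m::int. \<eta> \<noteq> Arg (lam j - lam k) + 2 * pi * of_int m))"

definition cut_plane :: "('n::finite \<Rightarrow> complex) \<Rightarrow> real \<Rightarrow> complex set" where
  "cut_plane lam \<eta> = - (\<Union>k. {lam k + of_real t * cis \<eta> | t. t \<ge> 0})"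

(* The logarithm of x with eta - 2 pi < arg x < eta: the rotation by pi - eta moves the cut of
   direction eta to the negative real axis, the cut of the principal branch Ln. *)

definition branch_ln :: "real \<Rightarrow> complex \<Rightarrow> complex" where
  "branch_ln \<eta> x = Ln (x * cis (pi - \<eta>)) + \<i> * of_real (\<eta> - pi)"

definition branch_powr :: "real \<Rightarrow> complex \<Rightarrow> complex \<Rightarrow> complex" where
  "branch_powr \<eta> x a = exp (a * branch_ln \<eta> x)"

lemma exp_branch_ln:
  assumes "x \<noteq> 0"
  shows "exp (branch_ln \<eta> x) = x"
proof -
  have "exp (branch_ln \<eta> x) = x * (cis (pi - \<eta>) * cis (\<eta> - pi))"
    using assms by (simp add: branch_ln_def exp_add cis_conv_exp)
  also have "\<dots> = x"
    by (simp only: cis_mult) simp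
  finally show ?thesis .
qed

lemma Im_branch_ln:
  assumes "\<And>t. t \<ge> 0 \<Longrightarrow> x \<noteq> of_real t * cis \<eta>"
  shows "\<eta> - 2 * pi < Im (branch_ln \<eta> x)" and "Im (branch_ln \<eta> x) < \<eta>"
proof -
  define y where "y = x * cis (pi - \<eta>)"
  have x: "x = y * cis (\<eta> - pi)"
    by (simp add: y_def mult.assoc cis_mult)
  have "x \<noteq> 0" using assms[of 0] by auto
  then have y0: "y \<noteq> 0" by (simp add: y_def)
  have "Im (Ln y) \<noteq> pi"
  proof
    assume "Im (Ln y) = pi"
    then have "y = of_real (cmod y) * cis pi"
      using y0 by (metis Arg_eq_Im_Ln rcis_cmod_Arg rcis_def)
    then have "x = of_real (cmod y) * (cis pi * cis (\<eta> - pi))"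
      using x by (metis mult.assoc)
    then have "x = of_real (cmod y) * cis \<eta>"
      by (simp only: cis_mult) simp
    with assms[of "cmod y"] show False by simp
  qed
  moreover have "- pi < Im (Ln y)" "Im (Ln y) \<le> pi"
    using y0 mpi_less_Im_Ln Im_Ln_le_pi by blast+
  ultimately show "\<eta> - 2 * pi < Im (branch_ln \<eta> x)" "Im (branch_ln \<eta> x) < \<eta>"
    by (simp_all add: branch_ln_def flip: y_def)
qed

(* f = g + reg(lambda - a) near a, for functions on P, where a lies in the closure of P. *)

definition eq_mod_reg ::
    "complex set \<Rightarrow> complex \<Rightarrow> (complex \<Rightarrow> complex^'n::finite) \<Rightarrow> (complex \<Rightarrow> complex^'n) \<Rightarrow> bool" where
  "eq_mod_reg P a f g \<longleftrightarrow>
     (\<exists>r. vec_analytic_on r {a} \<and> (\<forall>\<^sub>F z in at a within P. f z = g z + r z))"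

(* f is the continuation to P of the sum near a of the convergent series with terms s z l. *)

definition continues_series ::
    "complex set \<Rightarrow> complex \<Rightarrow> (complex \<Rightarrow> nat \<Rightarrow> complex^'n::finite) \<Rightarrow> (complex \<Rightarrow> complex^'n) \<Rightarrow> bool" where
  "continues_series P a s f \<longleftrightarrow>
     vec_holomorphic_on f P \<and> (\<forall>\<^sub>F z in at a within P. s z sums f z)"

(* G = F 0 + F 1 X + F 2 X^2 + ... with X = 1/z, so that d/dz acts on G as - X^2 d/dX.  Since
   Lambda' = diag(A1) commutes with the diagonal A0, the z-derivative of G e^(A0 z) z^Lambda' is
   (G' + G (A0 + Lambda'/z)) e^(A0 z) z^Lambda'; the equation below is
   Y' = (A0 + A1/z) Y with the factor e^(A0 z) z^Lambda' cancelled on the right. *)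

definition formal_solution_R ::
    "complex^'n::finite^'n \<Rightarrow> complex^'n^'n \<Rightarrow> (nat \<Rightarrow> complex^'n^'n) \<Rightarrow> bool" where
  "formal_solution_R A0 A1 F \<longleftrightarrow>
     F 0 = mat 1 \<and>
     (let G = (\<chi> i j. Abs_fps (\<lambda>l. F l $ i $ j));
          C = map_matrix fps_const;
          XC = map_matrix (\<lambda>a. fps_X * fps_const a)
      in map_matrix (\<lambda>g. - (fps_X ^ 2 * fps_deriv g)) G
           + G ** (C A0 + XC (diagonal_matrix (\<lambda>i. A1 $ i $ i)))
         = (C A0 + XC A1) ** G)"

definition solves_F ::
    "complex^'n::finite^'n \<Rightarrow> complex^'n^'n \<Rightarrow> complex set \<Rightarrow> (complex \<Rightarrow> complex^'n) \<Rightarrow> bool" where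
  "solves_F A0 A1 U \<Psi> \<longleftrightarrow>
     vec_holomorphic_on \<Psi> U \<and>
     (\<forall>z\<in>U. (A0 - mat z) *v vec_nderiv 1 \<Psi> z = (A1 + mat 1) *v \<Psi> z)"

definition residue_F :: "complex^'n::finite^'n \<Rightarrow> 'n \<Rightarrow> complex^'n^'n" where
  "residue_F A1 k = - ((\<chi> i j. if i = k \<and> j = k then 1 else 0) ** (A1 + mat 1))"

(* The Jordan normal form is formalized for matrices indexed by {..<n}; the enumeration e of the
   index type is immaterial. *)

definition has_nontrivial_jordan_block :: "complex^'n::finite^'n \<Rightarrow> bool" where
  "has_nontrivial_jordan_block B \<longleftrightarrow>
     (\<exists>(e :: nat \<Rightarrow> 'n) n_as.
        bij_betw e {..<CARD('n)} UNIV \<and>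
        jordan_nf (Matrix.mat CARD('n) CARD('n) (\<lambda>(i, j). B $ e i $ e j)) n_as \<and>
        (\<exists>(m, \<mu>)\<in>set n_as. m \<ge> 2))"

(* From here on lam i and A1 $ i $ i are the i-th diagonal entries of A0 and A1, F is the sequence
   of coefficients of the formal solution (F 0 the identity), and column k (F l) is the coefficient
   vector f_l^(k). *)

definition is_Psi ::
    "('n::finite \<Rightarrow> complex) \<Rightarrow> complex^'n^'n \<Rightarrow> (nat \<Rightarrow> complex^'n^'n) \<Rightarrow> real \<Rightarrow> 'n
      \<Rightarrow> (complex \<Rightarrow> complex^'n) \<Rightarrow> bool" where
  "is_Psi lam A1 F \<eta> k \<Psi> \<longleftrightarrow>
     (A1 $ k $ k \<notin> \<int> \<longrightarrow>
        continues_series (cut_plane lam \<eta>) (lam k)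
          (\<lambda>z l. (Gamma (A1 $ k $ k + 1 - of_nat l)
                   * branch_powr \<eta> (z - lam k) (of_nat l - A1 $ k $ k - 1)) *s column k (F l)) \<Psi>) \<and>
     (\<forall>N::int. A1 $ k $ k = of_int N \<and> N < 0 \<longrightarrow>
        continues_series (cut_plane lam \<eta>) (lam k)
          (\<lambda>z l. ((- 1) ^ nat (int l - N) / fact (nat (int l - N - 1))
                   * (z - lam k) ^ nat (int l - N - 1)) *s column k (F l)) \<Psi>) \<and>
     (\<forall>N::nat. A1 $ k $ k = of_nat N \<longrightarrow>
        continues_series (cut_plane lam \<eta>) (lam k)
          (\<lambda>z l. ((- 1) ^ (l + 1) / fact l * (z - lam k) ^ l) *s column k (F (N + l + 1))) \<Psi>)"

definition log_solution_nat ::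
    "('n::finite \<Rightarrow> complex) \<Rightarrow> complex^'n^'n \<Rightarrow> (nat \<Rightarrow> complex^'n^'n) \<Rightarrow> real \<Rightarrow> 'n \<Rightarrow> nat
      \<Rightarrow> (complex \<Rightarrow> complex^'n) \<Rightarrow> (complex \<Rightarrow> complex^'n) \<Rightarrow> bool" where
  "log_solution_nat lam A1 F \<eta> k N \<Psi> S \<longleftrightarrow>
     solves_F (diagonal_matrix lam) A1 (cut_plane lam \<eta>) S \<and>
     eq_mod_reg (cut_plane lam \<eta>) (lam k) S
       (\<lambda>z. branch_ln \<eta> (z - lam k) *s \<Psi> z
            + (1 / (z - lam k) ^ (N + 1)) *s
                (\<Sum>l=0..N. (fact (N - l) * (z - lam k) ^ l) *s column k (F l)))"

definition log_solution_neg ::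
    "('n::finite \<Rightarrow> complex) \<Rightarrow> complex^'n^'n \<Rightarrow> real \<Rightarrow> 'n
      \<Rightarrow> (complex \<Rightarrow> complex^'n) \<Rightarrow> (complex \<Rightarrow> complex^'n) \<Rightarrow> bool" where
  "log_solution_neg lam A1 \<eta> k \<Psi> S \<longleftrightarrow>
     solves_F (diagonal_matrix lam) A1 (cut_plane lam \<eta>) S \<and>
     eq_mod_reg (cut_plane lam \<eta>) (lam k) S (\<lambda>z. branch_ln \<eta> (z - lam k) *s \<Psi> z)"

(* The log solutions are determined only up to solutions analytic at lam k; any choice is allowed,
   and the connection coefficients do not depend on it. *)

definition is_Psi_sing ::
    "('n::finite \<Rightarrow> complex) \<Rightarrow> complex^'n^'n \<Rightarrow> (nat \<Rightarrow> complex^'n^'n) \<Rightarrow> real \<Rightarrow> 'n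
      \<Rightarrow> (complex \<Rightarrow> complex^'n) \<Rightarrow> (complex \<Rightarrow> complex^'n) \<Rightarrow> bool" where
  "is_Psi_sing lam A1 F \<eta> k \<Psi> S \<longleftrightarrow>
     (A1 $ k $ k \<notin> \<int> \<longrightarrow> (\<forall>z\<in>cut_plane lam \<eta>. S z = \<Psi> z)) \<and>
     (\<forall>N::nat. A1 $ k $ k = of_nat N \<longrightarrow> log_solution_nat lam A1 F \<eta> k N \<Psi> S) \<and>
     (A1 $ k $ k = - 1 \<longrightarrow> log_solution_neg lam A1 \<eta> k \<Psi> S) \<and>
     (\<forall>N::int. A1 $ k $ k = of_int N \<and> N \<le> - 2 \<longrightarrow>
        (if \<exists>T. log_solution_neg lam A1 \<eta> k \<Psi> T
         then log_solution_neg lam A1 \<eta> k \<Psi> S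
         else (\<forall>z\<in>cut_plane lam \<eta>. S z = 0)))"

definition is_connection_coeffs ::
    "('n::finite \<Rightarrow> complex) \<Rightarrow> complex^'n^'n \<Rightarrow> real
      \<Rightarrow> ('n \<Rightarrow> complex \<Rightarrow> complex^'n) \<Rightarrow> ('n \<Rightarrow> complex \<Rightarrow> complex^'n) \<Rightarrow> ('n \<Rightarrow> 'n \<Rightarrow> complex) \<Rightarrow> bool" where
  "is_connection_coeffs lam A1 \<eta> \<Psi> S c \<longleftrightarrow>
     (\<forall>j k. eq_mod_reg (cut_plane lam \<eta>) (lam j) (\<Psi> k) (\<lambda>z. c j k *s S j z)) \<and>
     (\<forall>j. (\<exists>N::int. A1 $ j $ j = of_int N \<and> N \<le> - 2) \<and> (\<forall>z\<in>cut_plane lam \<eta>. S j z = 0)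
        \<longrightarrow> (\<forall>k. c j k = 0))"

(* The q-primitive of Psi_k, for A1 $ k $ k not a natural number. *)

definition is_Psi_primitive ::
    "('n::finite \<Rightarrow> complex) \<Rightarrow> complex^'n^'n \<Rightarrow> (nat \<Rightarrow> complex^'n^'n) \<Rightarrow> real \<Rightarrow> 'n \<Rightarrow> nat
      \<Rightarrow> (complex \<Rightarrow> complex^'n) \<Rightarrow> bool" where
  "is_Psi_primitive lam A1 F \<eta> k q \<Phi> \<longleftrightarrow>
     (A1 $ k $ k \<notin> \<int> \<longrightarrow>
        continues_series (cut_plane lam \<eta>) (lam k)
          (\<lambda>z l. if l < q then 0 else
                   ((- 1) ^ q * Gamma (A1 $ k $ k + 1 - of_nat l)
                     * branch_powr \<eta> (z - lam k) (of_nat l - A1 $ k $ k - 1)) *s column k (F (l - q))) \<Phi>) \<and>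
     (\<forall>N::int. A1 $ k $ k = of_int N \<and> N < 0 \<longrightarrow>
        continues_series (cut_plane lam \<eta>) (lam k)
          (\<lambda>z l. if l < q then 0 else
                   ((- 1) ^ q * (- 1) ^ nat (int l - N) / fact (nat (int l - N - 1))
                     * (z - lam k) ^ nat (int l - N - 1)) *s column k (F (l - q))) \<Phi>)"

(* H r is hat Psi_k^[r] for A1 $ k $ k = N; hat Psi_k itself is H 0. *)

definition is_hat_Psi ::
    "('n::finite \<Rightarrow> complex) \<Rightarrow> (nat \<Rightarrow> complex^'n^'n) \<Rightarrow> real \<Rightarrow> 'n \<Rightarrow> nat
      \<Rightarrow> (int \<Rightarrow> complex \<Rightarrow> complex^'n) \<Rightarrow> bool" where
  "is_hat_Psi lam F \<eta> k N H \<longleftrightarrow>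
     (\<forall>q::nat. continues_series (cut_plane lam \<eta>) (lam k)
        (\<lambda>z l. if l < q then 0 else
                 ((- 1) ^ q * (- 1) ^ (l + N) / fact l * (z - lam k) ^ l) *s column k (F (l - q)))
        (H (- int q))) \<and>
     (\<forall>r::nat. \<forall>z\<in>cut_plane lam \<eta>. H (int r) z = vec_nderiv r (H 0) z)"

(* P^(j)_(Nj - Nk - 1), for Nj > Nk. *)

definition polar_poly ::
    "('n::finite \<Rightarrow> complex) \<Rightarrow> (nat \<Rightarrow> complex^'n^'n) \<Rightarrow> 'n \<Rightarrow> nat \<Rightarrow> nat \<Rightarrow> complex \<Rightarrow> complex^'n" where
  "polar_poly lam F j Nj Nk z =
     (- 1) ^ (Nk + 1) *s
       (\<Sum>l=0..Nj - Nk - 1. (fact (Nj - Nk - 1 - l) * (z - lam j) ^ l) *s column j (F l))"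

end

theory Submission
  imports Defs
begin

text \<open>Differentiating the expansions termwise shows that \<open>\<Psi>hat k 0\<close> is a primitive of order \<open>Nk + 1\<close>
  of \<open>\<Psi> k\<close>: this holds near \<open>lam k\<close>, hence on the connected cut plane. Near another branch point
  \<open>lam j\<close> the definition of the connection coefficients gives \<open>\<Psi> k = c j k *s \<Psi>sing j\<close> up to an
  analytic function. Two functions on a slit disc whose derivatives differ by an analytic function
  differ by an analytic function themselves, so it suffices to exhibit functions \<open>G q\<close> such that
  \<open>G 0\<close> is \<open>\<Psi>sing j\<close> and the derivative of \<open>G (Suc q)\<close> is \<open>G q\<close>, both up to analytic functions; then
  \<open>c j k *s G (Nk + 1)\<close> is the behaviour of \<open>\<Psi>hat k 0\<close> at \<open>lam j\<close>. In the logarithmic cases the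
  derivative of the logarithm contributes a simple pole with residue the value of the
  cofactor at \<open>lam j\<close>, which either vanishes or is absorbed by the polar part of \<open>G q\<close>.\<close>

section \<open>Geometry of the cut plane\<close>

text \<open>Rotation by \<open>cis (pi - \<eta>)\<close> carries the direction of the cuts to the
  negative real axis. Membership thus becomes the condition under which the \<open>Ln\<close> inside
  \<open>branch_ln\<close> is differentiable.\<close>

lemma mem_cut_plane_iff:
  "z \<in> cut_plane lam \<eta> \<longleftrightarrow> (\<forall>k. (z - lam k) * cis (pi - \<eta>) \<notin> \<real>\<^sub>\<le>\<^sub>0)"
proof -
  have "(\<exists>t\<ge>0. z = lam k + of_real t * cis \<eta>) \<longleftrightarrow> (z - lam k) * cis (pi - \<eta>) \<in> \<real>\<^sub>\<le>\<^sub>0" for k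
  proof
    assume "\<exists>t\<ge>0. z = lam k + of_real t * cis \<eta>"
    then obtain t :: real where t: "t \<ge> 0" "z = lam k + of_real t * cis \<eta>" by blast
    have "(z - lam k) * cis (pi - \<eta>) = of_real t * (cis \<eta> * cis (pi - \<eta>))"
      using t by simp
    also have "\<dots> = of_real (- t)"
      by (simp only: cis_mult) simp
    finally show "(z - lam k) * cis (pi - \<eta>) \<in> \<real>\<^sub>\<le>\<^sub>0"
      using t(1) by (simp only: complex_nonpos_Reals_iff) simp
  next
    assume R: "(z - lam k) * cis (pi - \<eta>) \<in> \<real>\<^sub>\<le>\<^sub>0"
    define s where "s = Re ((z - lam k) * cis (pi - \<eta>))"
    have s: "(z - lam k) * cis (pi - \<eta>) = of_real s" "s \<le> 0"
      using R by (auto simp: s_def complex_nonpos_Reals_iff complex_eq_iff)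
    have "z - lam k = (z - lam k) * (cis (pi - \<eta>) * cis (\<eta> - pi))"
      by (simp only: cis_mult) simp
    also have "\<dots> = of_real s * cis (\<eta> - pi)"
      using s(1) by (metis mult.assoc)
    also have "cis (\<eta> - pi) = - cis \<eta>"
      by (simp add: complex_eq_iff cos_diff sin_diff)
    finally have "z = lam k + of_real (- s) * cis \<eta>"
      by (simp add: algebra_simps)
    then show "\<exists>t\<ge>0. z = lam k + of_real t * cis \<eta>"
      using s(2) by (intro exI[of _ "- s"]) simp
  qed
  then show ?thesis
    unfolding cut_plane_def by auto
qed

lemma closed_cut: "closed {z. (z - a) * cis \<theta> \<in> \<real>\<^sub>\<le>\<^sub>0}"
proof -
  have "closed ((\<lambda>z. (z - a) * cis \<theta>) -` \<real>\<^sub>\<le>\<^sub>0)"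
    by (rule continuous_closed_vimage[OF closed_nonpos_Reals_complex]) (intro continuous_intros)
  then show ?thesis by (simp add: vimage_def)
qed

lemma open_cut_plane: "open (cut_plane lam \<eta>)"
proof -
  have "cut_plane lam \<eta> = (\<Inter>k. - {z. (z - lam k) * cis (pi - \<eta>) \<in> \<real>\<^sub>\<le>\<^sub>0})"
    using mem_cut_plane_iff[of _ lam \<eta>] by auto
  then show ?thesis
    using closed_cut by (auto intro!: open_INT)
qed

lemma branch_point_notin_cut_plane: "lam k \<notin> cut_plane lam \<eta>"
  by (subst mem_cut_plane_iff) (auto intro!: exI[of _ k])

text \<open>After translation and rotation the slit ball is the centred ball without the nonpositive
  reals, which is star-shaped about the positive real point \<open>d/2\<close>.\<close>

lemma connected_slit_ball:
  assumes "d > 0"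
  shows "connected (ball a d \<inter> {z. (z - a) * cis \<theta> \<notin> \<real>\<^sub>\<le>\<^sub>0})"
    and "ball a d \<inter> {z. (z - a) * cis \<theta> \<notin> \<real>\<^sub>\<le>\<^sub>0} \<noteq> {}"
proof -
  have star: "starlike (ball 0 d - \<real>\<^sub>\<le>\<^sub>0 :: complex set)"
    unfolding starlike_def
  proof (intro bexI[of _ "of_real (d/2)"] ballI subsetI)
    fix w x :: complex
    assume w: "w \<in> ball 0 d - \<real>\<^sub>\<le>\<^sub>0" and x: "x \<in> closed_segment (of_real (d/2)) w"
    obtain u where u: "0 \<le> u" "u \<le> 1" "x = (1 - u) *\<^sub>R of_real (d/2) + u *\<^sub>R w"
      using x by (auto simp: in_segment)
    have "x \<in> ball 0 d"
      using w x assms convex_ball[of 0 d] closed_segment_subset[of "of_real (d/2)" "ball 0 d" w]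
      by auto
    moreover have "x \<notin> \<real>\<^sub>\<le>\<^sub>0"
    proof
      assume "x \<in> \<real>\<^sub>\<le>\<^sub>0"
      then have x0: "Re x \<le> 0" "Im x = 0" by (auto simp: complex_nonpos_Reals_iff)
      \<comment> \<open>The centre of the star is real, so the imaginary part of \<open>x\<close> is
        \<open>u * Im w\<close>. In both cases \<open>x\<close> turns out to have positive real
        part.\<close>
      have "u = 0 \<or> Im w = 0" using x0 u by simp
      then show False
      proof
        assume "u = 0"
        then show False using x0 u assms by simp
      next
        assume "Im w = 0"
        then have "Re w > 0" using w by (auto simp: complex_nonpos_Reals_iff)
        then have "0 \<le> u * Re w" "u > 0 \<Longrightarrow> 0 < u * Re w"
          "0 \<le> (1 - u) * (d/2)" "u < 1 \<Longrightarrow> 0 < (1 - u) * (d/2)"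
          using u assms by simp_all
        moreover have "Re x = (1 - u) * (d/2) + u * Re w"
          using u by simp
        ultimately show False using x0 u by linarith
      qed
    qed
    ultimately show "x \<in> ball 0 d - \<real>\<^sub>\<le>\<^sub>0" by blast
  next
    show "complex_of_real (d/2) \<in> ball 0 d - \<real>\<^sub>\<le>\<^sub>0"
      using assms by (auto simp: complex_nonpos_Reals_iff)
  qed
  have *: "ball a d \<inter> {z. (z - a) * cis \<theta> \<notin> \<real>\<^sub>\<le>\<^sub>0}
      = (\<lambda>w. a + w * cis (- \<theta>)) ` (ball 0 d - \<real>\<^sub>\<le>\<^sub>0)" (is "?L = ?R")
  proof (intro equalityI subsetI)
    fix z assume z: "z \<in> ?L"
    have "a + (z - a) * cis \<theta> * cis (- \<theta>) = z"
      by (simp add: mult.assoc cis_mult)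
    moreover have "(z - a) * cis \<theta> \<in> ball 0 d - \<real>\<^sub>\<le>\<^sub>0"
      using z by (auto simp: norm_mult dist_norm norm_minus_commute)
    ultimately show "z \<in> ?R" by (metis imageI)
  next
    fix z assume "z \<in> ?R"
    then obtain w where w: "w \<in> ball 0 d - \<real>\<^sub>\<le>\<^sub>0" "z = a + w * cis (- \<theta>)" by blast
    then show "z \<in> ?L"
      by (auto simp: norm_mult dist_norm mult.assoc cis_mult)
  qed
  show "connected ?L"
    unfolding * by (intro connected_continuous_image continuous_intros starlike_imp_connected star)
  show "?L \<noteq> {}"
    using star unfolding * starlike_def by blast
qed

text \<open>Admissibility keeps \<open>lam j\<close> off the cuts issuing from the other branch
  points. These are finitely many closed sets, so a small ball about \<open>lam j\<close> meets at
  most its own cut.\<close>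

lemma cut_plane_near_branch_point:
  assumes "inj lam" and "admissible lam \<eta>"
  obtains d where "d > 0"
    "\<And>e. e \<le> d \<Longrightarrow> ball (lam j) e \<inter> cut_plane lam \<eta>
                 = ball (lam j) e \<inter> {z. (z - lam j) * cis (pi - \<eta>) \<notin> \<real>\<^sub>\<le>\<^sub>0}"
proof -
  define C where "C = (\<Union>k\<in>- {j}. {z. (z - lam k) * cis (pi - \<eta>) \<in> \<real>\<^sub>\<le>\<^sub>0})"
  have "closed C" unfolding C_def by (intro closed_UN ballI closed_cut) simp
  moreover have "lam j \<notin> C"
  proof
    assume "lam j \<in> C"
    then obtain k where k: "k \<noteq> j" "(lam j - lam k) * cis (pi - \<eta>) \<in> \<real>\<^sub>\<le>\<^sub>0"
      by (auto simp: C_def)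
    define x where "x = lam j - lam k"
    have x0: "x \<noteq> 0" using k(1) \<open>inj lam\<close> by (auto simp: x_def inj_def)
    have "x * cis (pi - \<eta>) = of_real (cmod x) * cis (Arg x + (pi - \<eta>))"
      using rcis_cmod_Arg[of x] by (metis rcis_def mult.assoc cis_mult)
    then have "sin (Arg x + (pi - \<eta>)) = 0" "cos (Arg x + (pi - \<eta>)) \<le> 0"
      using k(2) x0 by (auto simp: x_def[symmetric] complex_nonpos_Reals_iff mult_le_0_iff)
    then have "sin (\<eta> - Arg x) = 0" "cos (\<eta> - Arg x) \<ge> 0"
      by (simp_all add: sin_diff cos_diff sin_add cos_add algebra_simps)
    \<comment> \<open>A vanishing sine leaves the values 1 and -1 for the cosine. The sign selects
      1, so the angles agree modulo \<open>2 * pi\<close> and not merely modulo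
      \<open>pi\<close>.\<close>
    then have "cos (\<eta> - Arg x) = 1"
      using sin_cos_squared_add[of "\<eta> - Arg x"] by (auto simp: power2_eq_1_iff)
    then obtain m :: int where "\<eta> - Arg x = of_int m * 2 * pi"
      using cos_one_2pi_int by (metis mult.commute mult.left_commute)
    then have "\<eta> = Arg (lam j - lam k) + 2 * pi * of_int m"
      by (simp add: x_def algebra_simps)
    with assms(2) k(1) show False unfolding admissible_def by metis
  qed
  ultimately obtain d where d: "d > 0" "ball (lam j) d \<subseteq> - C"
    by (meson ComplI open_Compl open_contains_ball)
  show thesis
  proof (rule that[OF d(1)])
    fix e assume "e \<le> d"
    then have "ball (lam j) e \<subseteq> - C" using d(2) subset_ball by blast
    then have other: "(z - lam k) * cis (pi - \<eta>) \<notin> \<real>\<^sub>\<le>\<^sub>0" if "z \<in> ball (lam j) e" "k \<noteq> j" for z k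
      using that by (auto simp: C_def)
    have "z \<in> cut_plane lam \<eta> \<longleftrightarrow> (z - lam j) * cis (pi - \<eta>) \<notin> \<real>\<^sub>\<le>\<^sub>0" if "z \<in> ball (lam j) e" for z
      unfolding mem_cut_plane_iff using other[OF that] by metis
    then show "ball (lam j) e \<inter> cut_plane lam \<eta>
                 = ball (lam j) e \<inter> {z. (z - lam j) * cis (pi - \<eta>) \<notin> \<real>\<^sub>\<le>\<^sub>0}"
      by blast
  qed
qed

text \<open>From every point of the cut plane the ray of direction opposite to the cuts stays in the cut
  plane and eventually enters a half-plane free of cuts.\<close>

lemma connected_cut_plane: "connected (cut_plane (lam :: 'n::finite \<Rightarrow> complex) \<eta>)"
proof -
  define r where "r k = Re (lam k * cis (pi - \<eta>))" for k
  define M where "M = Max (range r)"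
  define H where "H = {z. Re (z * cis (pi - \<eta>)) > M}"
  define R where "R z = (\<lambda>t. z + of_real t * cis (\<eta> - pi)) ` {0..}" for z
  have rM: "r k \<le> M" for k unfolding M_def by (intro Max_ge) auto
  have HP: "H \<subseteq> cut_plane lam \<eta>"
  proof
    fix z assume "z \<in> H"
    then have "Re ((z - lam k) * cis (pi - \<eta>)) > 0" for k
      using rM[of k] by (simp add: H_def r_def algebra_simps)
    then show "z \<in> cut_plane lam \<eta>"
      by (auto simp: mem_cut_plane_iff complex_nonpos_Reals_iff not_le)
  qed
  have eq: "(z + of_real t * cis (\<eta> - pi)) * cis (pi - \<eta>) = z * cis (pi - \<eta>) + of_real t" for z t
    by (simp add: distrib_right mult.assoc cis_mult)
  have eq': "(z + of_real t * cis (\<eta> - pi) - w) * cis (pi - \<eta>)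
      = (z - w) * cis (pi - \<eta>) + of_real t" for z t w
    using eq[of "z - w" t] by (simp add: algebra_simps)
  have RP: "R z \<subseteq> cut_plane lam \<eta>" if "z \<in> cut_plane lam \<eta>" for z
  proof
    fix w assume "w \<in> R z"
    then obtain t where t: "t \<ge> 0" "w = z + of_real t * cis (\<eta> - pi)" by (auto simp: R_def)
    show "w \<in> cut_plane lam \<eta>"
      unfolding mem_cut_plane_iff
    proof
      fix k
      have "(z - lam k) * cis (pi - \<eta>) \<notin> \<real>\<^sub>\<le>\<^sub>0"
        using that by (simp add: mem_cut_plane_iff)
      then show "(w - lam k) * cis (pi - \<eta>) \<notin> \<real>\<^sub>\<le>\<^sub>0"
        using t(1) unfolding t(2) eq' by (auto simp: complex_nonpos_Reals_iff)
    qed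
  qed
  have conH: "connected H"
  proof -
    have "H = {z. inner (cis (\<eta> - pi)) z > M}"
      by (auto simp: H_def inner_complex_def cos_diff sin_diff algebra_simps)
    then show ?thesis by (simp add: convex_halfspace_gt convex_connected)
  qed
  have conR: "connected (R z)" for z
    unfolding R_def by (intro connected_continuous_image continuous_intros) auto
  have RH: "R z \<inter> H \<noteq> {}" for z
  proof -
    \<comment> \<open>Moving by \<open>t\<close> along the ray raises the rotated real part by
      exactly \<open>t\<close>, so this choice lifts it above \<open>M\<close>.\<close>
    define t where "t = \<bar>M - Re (z * cis (pi - \<eta>))\<bar> + 1"
    have "z + of_real t * cis (\<eta> - pi) \<in> R z" unfolding R_def by (rule imageI) (simp add: t_def)
    moreover have "z + of_real t * cis (\<eta> - pi) \<in> H"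
      unfolding H_def mem_Collect_eq eq by (simp add: t_def)
    ultimately show ?thesis by blast
  qed
  have zR: "z \<in> R z" for z unfolding R_def by (rule image_eqI[of _ _ 0]) auto
  have "cut_plane lam \<eta> = (\<Union>z\<in>cut_plane lam \<eta>. R z \<union> H)"
    using RP HP zR by blast
  moreover have "connected (\<Union>z\<in>cut_plane lam \<eta>. R z \<union> H)"
  proof (rule connected_Union)
    show "connected S" if "S \<in> (\<lambda>z. R z \<union> H) ` cut_plane lam \<eta>" for S
      using that conR conH RH by (auto intro!: connected_Un)
    show "\<Inter> ((\<lambda>z. R z \<union> H) ` cut_plane lam \<eta>) \<noteq> {}"
      using RH[of 0] by blast
  qed
  ultimately show ?thesis by simp
qed

section \<open>Derivatives of the chosen branches of logarithm and power\<close>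

lemma has_field_derivative_branch_ln:
  assumes "z \<in> cut_plane lam \<eta>"
  shows "((\<lambda>z. branch_ln \<eta> (z - lam j)) has_field_derivative 1 / (z - lam j)) (at z)"
proof -
  have *: "(z - lam j) * cis (pi - \<eta>) \<notin> \<real>\<^sub>\<le>\<^sub>0"
    using assms by (simp add: mem_cut_plane_iff)
  then have "z - lam j \<noteq> 0" by auto
  then show ?thesis
    unfolding branch_ln_def using *
    by (auto intro!: derivative_eq_intros simp: field_simps)
qed

lemma holomorphic_on_branch_ln:
  "(\<lambda>z. branch_ln \<eta> (z - lam j)) holomorphic_on cut_plane lam \<eta>"
  using has_field_derivative_branch_ln open_cut_plane by (subst holomorphic_on_open) blast+

lemma has_field_derivative_branch_powr:
  assumes "z \<in> cut_plane lam \<eta>"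
  shows "((\<lambda>z. branch_powr \<eta> (z - lam j) e) has_field_derivative
          e * branch_powr \<eta> (z - lam j) e / (z - lam j)) (at z)"
  unfolding branch_powr_def
  by (rule derivative_eq_intros has_field_derivative_branch_ln[OF assms] refl)+ simp

text \<open>Splits off integral powers, so that an expansion with nonintegral exponents becomes one
  branch factor times an ordinary power series.\<close>

lemma branch_powr_of_nat_add:
  assumes "x \<noteq> 0"
  shows "branch_powr \<eta> x (of_nat l + e) = x ^ l * branch_powr \<eta> x e"
  using exp_branch_ln[OF assms, of \<eta>]
  by (simp add: branch_powr_def distrib_right exp_add exp_of_nat_mult)

section \<open>Equality modulo analytic functions\<close>

text \<open>The scalar counterpart of \<open>eq_mod_reg\<close>: working with components makes
  \<open>deriv\<close> and scalar power series available.\<close>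

definition eq_mod_analytic ::
    "complex set \<Rightarrow> complex \<Rightarrow> (complex \<Rightarrow> complex) \<Rightarrow> (complex \<Rightarrow> complex) \<Rightarrow> bool" where
  "eq_mod_analytic P a f g \<longleftrightarrow>
     (\<exists>r. r analytic_on {a} \<and> (\<forall>\<^sub>F z in at a within P. f z = g z + r z))"

lemma eq_mod_reg_iff_components:
  "eq_mod_reg P a f g \<longleftrightarrow> (\<forall>i. eq_mod_analytic P a (\<lambda>z. f z $ i) (\<lambda>z. g z $ i))"
proof
  assume "eq_mod_reg P a f g"
  then obtain r where r: "vec_analytic_on r {a}" "\<forall>\<^sub>F z in at a within P. f z = g z + r z"
    by (auto simp: eq_mod_reg_def)
  show "\<forall>i. eq_mod_analytic P a (\<lambda>z. f z $ i) (\<lambda>z. g z $ i)"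
    unfolding eq_mod_analytic_def
  proof (intro allI exI conjI)
    fix i
    show "(\<lambda>z. r z $ i) analytic_on {a}" using r(1) by (simp add: vec_analytic_on_def)
    show "\<forall>\<^sub>F z in at a within P. f z $ i = g z $ i + r z $ i"
      using r(2) by eventually_elim simp
  qed
next
  assume "\<forall>i. eq_mod_analytic P a (\<lambda>z. f z $ i) (\<lambda>z. g z $ i)"
  then have "\<forall>i. \<exists>r. r analytic_on {a} \<and> (\<forall>\<^sub>F z in at a within P. f z $ i = g z $ i + r z)"
    unfolding eq_mod_analytic_def .
  from choice[OF this] obtain r where r: "\<And>i. r i analytic_on {a}"
    "\<And>i. \<forall>\<^sub>F z in at a within P. f z $ i = g z $ i + r i z"
    by blast
  show "eq_mod_reg P a f g"
    unfolding eq_mod_reg_def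
  proof (intro exI conjI)
    show "vec_analytic_on (\<lambda>z. \<chi> i. r i z) {a}"
      using r(1) by (simp add: vec_analytic_on_def)
    have "\<forall>\<^sub>F z in at a within P. \<forall>i. f z $ i = g z $ i + r i z"
      using r(2) by (simp add: eventually_all_finite)
    then show "\<forall>\<^sub>F z in at a within P. f z = g z + (\<chi> i. r i z)"
      by eventually_elim (simp add: vec_eq_iff)
  qed
qed

lemma eq_mod_analyticI:
  assumes "\<forall>\<^sub>F z in at a within P. f z = g z"
  shows "eq_mod_analytic P a f g"
  unfolding eq_mod_analytic_def using assms by (intro exI[of _ "\<lambda>_. 0"]) auto

lemma eq_mod_analytic_trans [trans]:
  assumes "eq_mod_analytic P a f g" "eq_mod_analytic P a g h"
  shows "eq_mod_analytic P a f h"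
proof -
  obtain r s where r: "r analytic_on {a}" "\<forall>\<^sub>F z in at a within P. f z = g z + r z"
    and s: "s analytic_on {a}" "\<forall>\<^sub>F z in at a within P. g z = h z + s z"
    using assms by (auto simp: eq_mod_analytic_def)
  have "\<forall>\<^sub>F z in at a within P. f z = h z + (r z + s z)"
    using r(2) s(2) by eventually_elim simp
  then show ?thesis
    unfolding eq_mod_analytic_def using analytic_on_add[OF r(1) s(1)] by blast
qed

lemma eq_mod_analytic_add:
  assumes "eq_mod_analytic P a f g" "eq_mod_analytic P a f' g'"
  shows "eq_mod_analytic P a (\<lambda>z. f z + f' z) (\<lambda>z. g z + g' z)"
proof -
  obtain r s where r: "r analytic_on {a}" "\<forall>\<^sub>F z in at a within P. f z = g z + r z"
    and s: "s analytic_on {a}" "\<forall>\<^sub>F z in at a within P. f' z = g' z + s z"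
    using assms by (auto simp: eq_mod_analytic_def)
  have "\<forall>\<^sub>F z in at a within P. f z + f' z = g z + g' z + (r z + s z)"
    using r(2) s(2) by eventually_elim simp
  then show ?thesis
    unfolding eq_mod_analytic_def using analytic_on_add[OF r(1) s(1)] by blast
qed

lemma eq_mod_analytic_sym:
  assumes "eq_mod_analytic P a f g"
  shows "eq_mod_analytic P a g f"
proof -
  obtain r where r: "r analytic_on {a}" "\<forall>\<^sub>F z in at a within P. f z = g z + r z"
    using assms by (auto simp: eq_mod_analytic_def)
  have "\<forall>\<^sub>F z in at a within P. g z = f z + - r z"
    using r(2) by eventually_elim simp
  then show ?thesis
    unfolding eq_mod_analytic_def using analytic_on_neg[OF r(1)] by blast
qed

lemma eq_mod_analytic_cmult:
  assumes "eq_mod_analytic P a f g"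
  shows "eq_mod_analytic P a (\<lambda>z. C * f z) (\<lambda>z. C * g z)"
proof -
  obtain r where r: "r analytic_on {a}" "\<forall>\<^sub>F z in at a within P. f z = g z + r z"
    using assms by (auto simp: eq_mod_analytic_def)
  have "\<forall>\<^sub>F z in at a within P. C * f z = C * g z + C * r z"
    using r(2) by eventually_elim (simp add: distrib_left)
  moreover have "(\<lambda>z. C * r z) analytic_on {a}"
    using r(1) by (intro analytic_intros)
  ultimately show ?thesis
    unfolding eq_mod_analytic_def by blast
qed

lemma eq_mod_analytic_refl: "eq_mod_analytic P a f f"
  by (simp add: eq_mod_analyticI)

text \<open>The difference quotient of \<open>h\<close> at \<open>a\<close> has a removable
  singularity, so modulo analytic functions only the simple pole with residue \<open>h a\<close>
  survives.\<close>

lemma eq_mod_analytic_divide: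
  assumes h: "h analytic_on {a}" and f: "\<forall>\<^sub>F z in at a within P. f z = h z"
  shows "eq_mod_analytic P a (\<lambda>z. f z / (z - a)) (\<lambda>z. h a / (z - a))"
proof -
  obtain e where e: "e > 0" "h holomorphic_on ball a e"
    using h by (auto simp: analytic_at_ball)
  define r where "r z = (if z = a then deriv h a else (h z - h a) / (z - a))" for z
  have "r holomorphic_on ball a e"
    unfolding r_def by (rule pole_lemma_open[OF e(2)]) simp
  then have "r analytic_on {a}" using e(1) by (auto simp: analytic_at_ball)
  moreover have "\<forall>\<^sub>F z in at a within P. f z / (z - a) = h a / (z - a) + r z"
  proof -
    have "\<forall>\<^sub>F z in at a within P. z \<noteq> a" by (simp add: eventually_at_filter)
    with f show ?thesis by eventually_elim (simp add: r_def diff_divide_distrib)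
  qed
  ultimately show ?thesis unfolding eq_mod_analytic_def by blast
qed

section \<open>Functions on a domain slit at a boundary point\<close>

text \<open>The local features of the cut plane at a branch point. Connectedness of the small slit
  balls makes constants of integration unique, and nonemptiness guarantees sample points arbitrarily
  close to \<open>a\<close>.\<close>

locale cut_point =
  fixes P :: "complex set" and a :: complex
  assumes open_domain: "open P"
    and notin_domain: "a \<notin> P"
    and small_balls: "\<exists>d>0. \<forall>e. 0 < e \<and> e \<le> d \<longrightarrow> connected (ball a e \<inter> P) \<and> ball a e \<inter> P \<noteq> {}"
begin

lemma eventually_domain: "\<forall>\<^sub>F z in at a within P. z \<in> P \<and> z \<noteq> a"
  by (auto simp: eventually_at_filter)

lemma eventually_near:
  assumes "\<forall>\<^sub>F z in at a within P. Q z"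
  obtains d where "d > 0"
    "\<forall>e. 0 < e \<and> e \<le> d \<longrightarrow> connected (ball a e \<inter> P) \<and> ball a e \<inter> P \<noteq> {}"
    "\<forall>z\<in>ball a d \<inter> P. Q z"
proof -
  obtain d1 where d1: "d1 > 0" "\<And>z. z \<in> P \<Longrightarrow> z \<noteq> a \<Longrightarrow> dist z a < d1 \<Longrightarrow> Q z"
    using assms by (auto simp: eventually_at)
  obtain d2 where d2: "d2 > 0" "\<forall>e. 0 < e \<and> e \<le> d2 \<longrightarrow> connected (ball a e \<inter> P) \<and> ball a e \<inter> P \<noteq> {}"
    using small_balls by blast
  show thesis
  proof (rule that[of "min d1 d2"])
    have "Q z" if z: "z \<in> ball a (min d1 d2) \<inter> P" for z
    proof -
      have "z \<noteq> a" using z notin_domain by auto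
      then show "Q z" using z by (intro d1(2)) (auto simp: dist_commute)
    qed
    then show "\<forall>z\<in>ball a (min d1 d2) \<inter> P. Q z" by blast
  qed (use d1 d2 in auto)
qed

lemma eventually_ball: "d > 0 \<Longrightarrow> \<forall>\<^sub>F z in at a within P. z \<in> ball a d"
  by (auto simp: eventually_at dist_commute)

text \<open>Since the domain is open, an identity near \<open>a\<close> also holds in a full
  neighbourhood of each nearby point of the domain and may therefore be differentiated.\<close>

lemma eventually_locally:
  assumes "\<forall>\<^sub>F z in at a within P. Q z"
  shows "\<forall>\<^sub>F z in at a within P. \<forall>\<^sub>F w in nhds z. Q w"
proof -
  obtain d where d: "d > 0" "\<forall>z\<in>ball a d \<inter> P. Q z"
    by (rule eventually_near[OF assms])
  show ?thesis
    using eventually_domain eventually_ball[OF d(1)]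
  proof eventually_elim
    case (elim z)
    then have "\<forall>\<^sub>F w in nhds z. w \<in> ball a d \<inter> P"
      using open_domain by (intro eventually_nhds_in_open) auto
    then show ?case by eventually_elim (use d(2) in blast)
  qed
qed

lemma eventually_deriv_cong:
  assumes "\<forall>\<^sub>F z in at a within P. f z = g z"
  shows "\<forall>\<^sub>F z in at a within P. deriv f z = deriv g z"
  using eventually_locally[OF assms] by eventually_elim (rule deriv_cong_ev, auto)

text \<open>The analytic error \<open>r\<close> is integrated to \<open>R\<close>, and
  \<open>f - g - R\<close> has derivative zero on a connected slit ball. It is therefore a constant,
  which joins \<open>R\<close> in the analytic error.\<close>

lemma eq_mod_analytic_of_deriv:
  assumes f: "f holomorphic_on P" and g: "g holomorphic_on P"
    and fg: "eq_mod_analytic P a (deriv f) (deriv g)"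
  shows "eq_mod_analytic P a f g"
proof -
  obtain r where r: "r analytic_on {a}" "\<forall>\<^sub>F z in at a within P. deriv f z = deriv g z + r z"
    using fg by (auto simp: eq_mod_analytic_def)
  obtain e where e: "e > 0" "r holomorphic_on ball a e"
    using r(1) by (auto simp: analytic_at_ball)
  obtain d where d: "d > 0"
    "\<forall>e. 0 < e \<and> e \<le> d \<longrightarrow> connected (ball a e \<inter> P) \<and> ball a e \<inter> P \<noteq> {}"
    "\<forall>z\<in>ball a d \<inter> P. deriv f z = deriv g z + r z"
    by (rule eventually_near[OF r(2)])
  \<comment> \<open>The primitive is taken on the full ball, across the cut, so that it is analytic
    at \<open>a\<close> itself.\<close>
  obtain R where R: "\<And>z. z \<in> ball a e \<Longrightarrow> (R has_field_derivative r z) (at z within ball a e)"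
    using holomorphic_convex_primitive'[OF convex_ball open_ball e(2)] by blast
  have R': "(R has_field_derivative r z) (at z)" if "z \<in> ball a e" for z
    using R[OF that] that by (simp add: at_within_open[of z "ball a e"])
  define m where "m = min d e"
  let ?S = "ball a m \<inter> P"
  have m: "m > 0" "m \<le> d" "m \<le> e" using d e by (auto simp: m_def)
  have D: "((\<lambda>z. f z - g z - R z) has_field_derivative 0) (at z)" if "z \<in> ?S" for z
  proof -
    have "z \<in> P" "z \<in> ball a e" "z \<in> ball a d" using that m by auto
    then have "(f has_field_derivative deriv f z) (at z)" "(g has_field_derivative deriv g z) (at z)"
      "(R has_field_derivative r z) (at z)"
      using holomorphic_derivI[OF f open_domain] holomorphic_derivI[OF g open_domain] R' by simp_all
    then have "((\<lambda>z. f z - g z - R z) has_field_derivative deriv f z - deriv g z - r z) (at z)"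
      by (intro derivative_intros)
    moreover have "deriv f z - deriv g z - r z = 0"
      using d(3) \<open>z \<in> ball a d\<close> \<open>z \<in> P\<close> by simp
    ultimately show ?thesis by simp
  qed
  have "continuous_on ?S (\<lambda>z. f z - g z - R z)"
    by (rule DERIV_continuous_on) (rule has_field_derivative_at_within[OF D])
  moreover have "connected ?S" "open ?S"
    using d(2) m open_domain by auto
  ultimately obtain C where C: "\<And>z. z \<in> ?S \<Longrightarrow> f z - g z - R z = C"
    using DERIV_zero_connected_constant[of ?S "{}" "\<lambda>z. f z - g z - R z"] D by auto
  have "R holomorphic_on ball a e"
    using R' by (subst holomorphic_on_open) blast+
  then have "R analytic_on {a}" using e(1) by (auto simp: analytic_at_ball)
  then have "(\<lambda>z. R z + C) analytic_on {a}" by (intro analytic_intros)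
  moreover have "\<forall>\<^sub>F z in at a within P. f z = g z + (R z + C)"
    using eventually_domain eventually_ball[OF m(1)]
  proof eventually_elim
    case (elim z)
    then show ?case using C[of z] by (simp add: algebra_simps)
  qed
  ultimately show ?thesis unfolding eq_mod_analytic_def by blast
qed

text \<open>Induction on the order, with \<open>f\<close> arbitrary: the hypothesis is applied to
  \<open>deriv f\<close>, and one integration then passes from \<open>G q\<close> to
  \<open>G (Suc q)\<close>.\<close>

lemma eq_mod_analytic_of_higher_deriv:
  assumes G: "\<And>q. G q holomorphic_on P"
    and dG: "\<And>q. eq_mod_analytic P a (deriv (G (Suc q))) (G q)"
    and f: "f holomorphic_on P"
    and fG: "eq_mod_analytic P a ((deriv ^^ q) f) (\<lambda>z. C * G 0 z)"
  shows "eq_mod_analytic P a f (\<lambda>z. C * G q z)"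
  using f fG
proof (induction q arbitrary: f)
  case (Suc q)
  have CG: "(\<lambda>z. C * G (Suc q) z) holomorphic_on P"
    using G by (intro holomorphic_intros)
  have "eq_mod_analytic P a (deriv f) (\<lambda>z. C * G q z)"
  proof (rule Suc.IH)
    show "deriv f holomorphic_on P"
      using Suc.prems(1) open_domain by (rule holomorphic_deriv)
    show "eq_mod_analytic P a ((deriv ^^ q) (deriv f)) (\<lambda>z. C * G 0 z)"
      using Suc.prems(2) by (simp add: funpow_swap1)
  qed
  also have "eq_mod_analytic P a (\<lambda>z. C * G q z) (\<lambda>z. C * deriv (G (Suc q)) z)"
    by (rule eq_mod_analytic_cmult[OF eq_mod_analytic_sym[OF dG]])
  also have "eq_mod_analytic P a (\<lambda>z. C * deriv (G (Suc q)) z) (deriv (\<lambda>z. C * G (Suc q) z))"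
  proof (rule eq_mod_analyticI)
    show "\<forall>\<^sub>F z in at a within P. C * deriv (G (Suc q)) z = deriv (\<lambda>z. C * G (Suc q) z) z"
      using eventually_domain
    proof eventually_elim
      case (elim z)
      then have "G (Suc q) field_differentiable at z"
        using G[of "Suc q"] open_domain holomorphic_on_imp_differentiable_at by blast
      then show ?case by simp
    qed
  qed
  finally show ?case
    by (rule eq_mod_analytic_of_deriv[OF Suc.prems(1) CG])
qed simp

section \<open>Convergent expansions at the boundary point\<close>

text \<open>Convergence inside the slit domain already forces convergence on a full disc about
  \<open>a\<close>. The sum there is the analytic extension \<open>h\<close> of \<open>f\<close>
  across the cut, and it may be differentiated termwise.\<close>

lemma power_series_near:
  assumes "\<forall>\<^sub>F z in at a within P. (\<lambda>l. c l * (z - a) ^ l) sums f z"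
  obtains h where "h analytic_on {a}" "h a = c 0" "\<forall>\<^sub>F z in at a within P. f z = h z"
    "\<forall>\<^sub>F z in at a within P. (h has_field_derivative deriv h z) (at z)"
    "\<forall>\<^sub>F z in at a within P. (\<lambda>l. diffs c l * (z - a) ^ l) sums deriv h z"
proof -
  obtain d where d: "d > 0"
    "\<forall>e. 0 < e \<and> e \<le> d \<longrightarrow> connected (ball a e \<inter> P) \<and> ball a e \<inter> P \<noteq> {}"
    "\<forall>z\<in>ball a d \<inter> P. (\<lambda>l. c l * (z - a) ^ l) sums f z"
    by (rule eventually_near[OF assms])
  \<comment> \<open>A single point of convergence suffices: its distance from \<open>a\<close>
    serves as the radius of the disc.\<close>
  then obtain w where w: "w \<in> ball a d \<inter> P" by blast
  then have sw: "summable (\<lambda>l. c l * (w - a) ^ l)" using d(3) sums_summable by blast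
  define e where "e = norm (w - a)"
  have e: "e > 0" using w notin_domain by (auto simp: e_def)
  have sm: "summable (\<lambda>l. c l * x ^ l)" if "norm x < e" for x
    using powser_inside[OF sw] that by (simp add: e_def)
  define h where "h z = (\<Sum>l. c l * (z - a) ^ l)" for z
  have dh: "(h has_field_derivative (\<Sum>l. diffs c l * (z - a) ^ l)) (at z)"
    and sd: "summable (\<lambda>l. diffs c l * (z - a) ^ l)" if "z \<in> ball a e" for z
  proof -
    have n: "norm (z - a) < e" using that by (simp add: dist_norm norm_minus_commute)
    have "((\<lambda>x. \<Sum>l. c l * x ^ l) has_field_derivative (\<Sum>l. diffs c l * (z - a) ^ l)) (at (z - a))"
      using termdiffs_strong'[OF sm n] by simp
    then show "(h has_field_derivative (\<Sum>l. diffs c l * (z - a) ^ l)) (at z)"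
      unfolding h_def by (rule DERIV_chain2[where g = "\<lambda>z. z - a", THEN DERIV_cong])
        (auto intro!: derivative_eq_intros)
    show "summable (\<lambda>l. diffs c l * (z - a) ^ l)"
      using termdiff_converges[OF n sm] by simp
  qed
  have dh': "deriv h z = (\<Sum>l. diffs c l * (z - a) ^ l)" if "z \<in> ball a e" for z
    using dh[OF that] by (rule DERIV_imp_deriv)
  show thesis
  proof (rule that)
    have "h holomorphic_on ball a e" using dh by (subst holomorphic_on_open) blast+
    then show "h analytic_on {a}" using e by (auto simp: analytic_at_ball)
    show "h a = c 0" by (simp add: h_def)
    show "\<forall>\<^sub>F z in at a within P. f z = h z"
      using assms by eventually_elim (simp add: h_def sums_iff)
    show "\<forall>\<^sub>F z in at a within P. (h has_field_derivative deriv h z) (at z)"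
      using eventually_ball[OF e] by eventually_elim (simp only: dh' dh)
    show "\<forall>\<^sub>F z in at a within P. (\<lambda>l. diffs c l * (z - a) ^ l) sums deriv h z"
      using eventually_ball[OF e] by eventually_elim (metis dh' sd summable_sums)
  qed
qed

lemma sums_deriv:
  assumes "\<forall>\<^sub>F z in at a within P. (\<lambda>l. c l * (z - a) ^ l) sums f z"
  shows "\<forall>\<^sub>F z in at a within P. (\<lambda>l. diffs c l * (z - a) ^ l) sums deriv f z"
proof -
  obtain h where "h analytic_on {a}" "h a = c 0" and h: "\<forall>\<^sub>F z in at a within P. f z = h z"
    and "\<forall>\<^sub>F z in at a within P. (h has_field_derivative deriv h z) (at z)"
    and h': "\<forall>\<^sub>F z in at a within P. (\<lambda>l. diffs c l * (z - a) ^ l) sums deriv h z"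
    by (rule power_series_near[OF assms])
  show ?thesis using eventually_deriv_cong[OF h] h' by eventually_elim simp
qed

text \<open>The differential equation for \<open>W\<close> is that of the power of
  \<open>z - a\<close> with exponent \<open>e\<close>. Writing \<open>f\<close> as \<open>W\<close>
  times a power series, the product rule reduces the claim to comparing coefficients; the condition
  on \<open>b 0\<close> removes the term with exponent \<open>e - 1\<close>.\<close>

lemma deriv_weighted_power_series:
  assumes W: "\<And>z. z \<in> P \<Longrightarrow> (W has_field_derivative e * W z / (z - a)) (at z)"
    and W0: "\<And>z. z \<in> P \<Longrightarrow> W z \<noteq> 0"
    and f: "\<forall>\<^sub>F z in at a within P. (\<lambda>l. W z * (b l * (z - a) ^ l)) sums f z"
    and g: "\<forall>\<^sub>F z in at a within P. (\<lambda>l. W z * (c l * (z - a) ^ l)) sums g z"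
    and b0: "e * b 0 = 0" and bc: "\<And>l. (of_nat (Suc l) + e) * b (Suc l) = c l"
  shows "\<forall>\<^sub>F z in at a within P. deriv f z = g z"
proof -
  have f': "\<forall>\<^sub>F z in at a within P. (\<lambda>l. b l * (z - a) ^ l) sums (f z / W z)"
    using f eventually_domain
  proof eventually_elim
    case (elim z)
    then show ?case
      using sums_divide[of "\<lambda>l. W z * (b l * (z - a) ^ l)" "f z" "W z"] W0[of z] by simp
  qed
 obtain h where "h analytic_on {a}" "h a = b 0"
    and h: "\<forall>\<^sub>F z in at a within P. f z / W z = h z"
    "\<forall>\<^sub>F z in at a within P. (h has_field_derivative deriv h z) (at z)"
    "\<forall>\<^sub>F z in at a within P. (\<lambda>l. diffs b l * (z - a) ^ l) sums deriv h z"
    by (rule power_series_near[OF f'])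
  have "\<forall>\<^sub>F z in at a within P. f z = W z * h z"
    using h(1) eventually_domain by eventually_elim (use W0 in \<open>auto simp: field_simps\<close>)
  from eventually_deriv_cong[OF this] h(1) h(2) h(3) f' g eventually_domain
  show ?thesis
  proof eventually_elim
    case (elim z)
    have z: "z \<in> P" "z - a \<noteq> 0" "W z \<noteq> 0" using elim W0 by auto
    have "((\<lambda>z. W z * h z) has_field_derivative W z * deriv h z + e * W z / (z - a) * h z) (at z)"
      using W[OF z(1)] elim(3) by (rule DERIV_mult')
    then have 1: "deriv f z = W z * deriv h z + e * W z / (z - a) * h z"
      using elim(1) DERIV_imp_deriv by metis
    \<comment> \<open>The claim is first proved multiplied by \<open>z - a\<close>, which turns the
      logarithmic derivative of the weight into the constant \<open>e\<close>. The two series then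
      align after shifting one index, and the omitted term \<open>e * b 0\<close> is zero.\<close>
    have "(\<lambda>l. (z - a) * (diffs b l * (z - a) ^ l)) sums ((z - a) * deriv h z)"
      by (rule sums_mult) (rule elim(4))
    moreover have "(\<lambda>l. e * (b (Suc l) * (z - a) ^ Suc l)) sums (e * (h z - b 0))"
    proof (rule sums_mult)
      show "(\<lambda>l. b (Suc l) * (z - a) ^ Suc l) sums (h z - b 0)"
        using elim(5) by (subst sums_Suc_iff) (simp add: elim(2))
    qed
    ultimately have "(\<lambda>l. (z - a) * (diffs b l * (z - a) ^ l) + e * (b (Suc l) * (z - a) ^ Suc l)) sums
        ((z - a) * deriv h z + e * (h z - b 0))"
      by (rule sums_add)
    also have "(\<lambda>l. (z - a) * (diffs b l * (z - a) ^ l) + e * (b (Suc l) * (z - a) ^ Suc l))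
        = (\<lambda>l. (z - a) * (c l * (z - a) ^ l))"
      by (rule ext) (simp add: diffs_def bc[symmetric] algebra_simps)
    finally have "(\<lambda>l. W z * ((z - a) * (c l * (z - a) ^ l))) sums (W z * ((z - a) * deriv h z + e * (h z - b 0)))"
      by (rule sums_mult)
    moreover have "(\<lambda>l. W z * ((z - a) * (c l * (z - a) ^ l))) sums ((z - a) * g z)"
      using sums_mult[OF elim(6), of "z - a"] by (simp only: mult.left_commute)
    ultimately have "W z * ((z - a) * deriv h z + e * (h z - b 0)) = (z - a) * g z"
      by (rule sums_unique2)
    then have *: "W z * ((z - a) * deriv h z + e * h z) = (z - a) * g z"
      using b0 by (simp only: right_diff_distrib diff_zero)
    have "d * (w * x + e * w / d * y) = w * (d * x + e * y)" if "d \<noteq> 0" for d w x y :: complex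
      using that by (simp add: field_simps)
    from this[OF z(2)] have "(z - a) * deriv f z = W z * ((z - a) * deriv h z + e * h z)"
      unfolding 1 .
    with * have "(z - a) * deriv f z = (z - a) * g z"
      by simp
    then show ?case using z(2) by simp
  qed
qed

end

context cut_point
begin

section \<open>Logarithmic terms\<close>

lemma deriv_log_times:
  assumes L: "\<And>z. z \<in> P \<Longrightarrow> (L has_field_derivative 1 / (z - a)) (at z)"
    and f: "f holomorphic_on P" and f': "\<forall>\<^sub>F z in at a within P. deriv f z = g z"
    and h: "h analytic_on {a}" "\<forall>\<^sub>F z in at a within P. f z = h z"
  shows "eq_mod_analytic P a (deriv (\<lambda>z. L z * f z)) (\<lambda>z. L z * g z + h a / (z - a))"
proof -
  have "\<forall>\<^sub>F z in at a within P. deriv (\<lambda>z. L z * f z) z = L z * g z + f z / (z - a)"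
    using f' eventually_domain
  proof eventually_elim
    case (elim z)
    have "((\<lambda>z. L z * f z) has_field_derivative L z * deriv f z + 1 / (z - a) * f z) (at z)"
      using elim(2) by (intro DERIV_mult' L holomorphic_derivI[OF f open_domain]) simp_all
    then show ?case using elim by (simp add: DERIV_imp_deriv)
  qed
  then have "eq_mod_analytic P a (deriv (\<lambda>z. L z * f z)) (\<lambda>z. L z * g z + f z / (z - a))"
    by (rule eq_mod_analyticI)
  also have "eq_mod_analytic P a (\<lambda>z. L z * g z + f z / (z - a)) (\<lambda>z. L z * g z + h a / (z - a))"
    by (rule eq_mod_analytic_add[OF eq_mod_analytic_refl eq_mod_analytic_divide[OF h]])
  finally show ?thesis .
qed

section \<open>Repeated primitives of weighted power series\<close>

text \<open>Here \<open>\<kappa>\<close> stands for the Gamma or reciprocal factorial factor, which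
  stays tied to the exponent, and \<open>u\<close> for a component of the formal coefficients. Only
  \<open>u\<close> is shifted by \<open>q\<close>.\<close>

definition primitive_coeff :: "(nat \<Rightarrow> complex) \<Rightarrow> (nat \<Rightarrow> complex) \<Rightarrow> nat \<Rightarrow> nat \<Rightarrow> complex" where
  "primitive_coeff \<kappa> u q l = (if l < q then 0 else (- 1) ^ q * \<kappa> l * u (l - q))"

text \<open>Raising \<open>l\<close> and \<open>q\<close> together leaves \<open>l - q\<close>
  fixed, so only the recurrence of \<open>\<kappa>\<close> matters; its minus sign is absorbed by
  the sign factor. The leading coefficient of index \<open>Suc q\<close> vanishes, which settles the
  condition at \<open>l = 0\<close> for every \<open>e\<close>.\<close>

lemma deriv_primitive:
  assumes W: "\<And>z. z \<in> P \<Longrightarrow> (W has_field_derivative e * W z / (z - a)) (at z)"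
    and W0: "\<And>z. z \<in> P \<Longrightarrow> W z \<noteq> 0"
    and \<kappa>: "\<And>l. (of_nat (Suc l) + e) * \<kappa> (Suc l) = - \<kappa> l"
    and \<Phi>: "\<And>q. \<forall>\<^sub>F z in at a within P.
             (\<lambda>l. W z * (primitive_coeff \<kappa> u q l * (z - a) ^ l)) sums \<Phi> q z"
  shows "\<forall>\<^sub>F z in at a within P. deriv (\<Phi> (Suc q)) z = \<Phi> q z"
proof (rule deriv_weighted_power_series[OF W W0 \<Phi> \<Phi>])
  show "e * primitive_coeff \<kappa> u (Suc q) 0 = 0" by (simp add: primitive_coeff_def)
  fix l
  show "(of_nat (Suc l) + e) * primitive_coeff \<kappa> u (Suc q) (Suc l) = primitive_coeff \<kappa> u q l"
  proof (cases "l < q")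
    case False
    have "(of_nat (Suc l) + e) * primitive_coeff \<kappa> u (Suc q) (Suc l)
        = - ((- 1) ^ q * ((of_nat (Suc l) + e) * \<kappa> (Suc l)) * u (l - q))"
      using False by (simp add: primitive_coeff_def algebra_simps)
    also have "\<dots> = primitive_coeff \<kappa> u q l"
      unfolding \<kappa> using False by (simp add: primitive_coeff_def)
    finally show ?thesis .
  qed (simp add: primitive_coeff_def)
qed

text \<open>With the weight a natural power, \<open>\<Phi> (Suc q)\<close> extends analytically to
  \<open>a\<close> and vanishes there, even for \<open>p = 0\<close>, because its leading
  coefficient is zero. Hence differentiating the logarithm produces no pole.\<close>

lemma log_primitive:
  assumes L: "\<And>z. z \<in> P \<Longrightarrow> (L has_field_derivative 1 / (z - a)) (at z)"
    and hol: "\<And>q. \<Phi> q holomorphic_on P"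
    and \<kappa>: "\<And>l. of_nat (Suc l + p) * \<kappa> (Suc l) = - \<kappa> l"
    and \<Phi>: "\<And>q. \<forall>\<^sub>F z in at a within P.
             (\<lambda>l. (z - a) ^ p * (primitive_coeff \<kappa> u q l * (z - a) ^ l)) sums \<Phi> q z"
  shows "eq_mod_analytic P a (deriv (\<lambda>z. L z * \<Phi> (Suc q) z)) (\<lambda>z. L z * \<Phi> q z)"
proof -
  let ?W = "\<lambda>z. (z - a) ^ p"
  have W0: "?W z \<noteq> 0" if "z \<in> P" for z using that notin_domain by auto
  have W: "(?W has_field_derivative of_nat p * ?W z / (z - a)) (at z)" if "z \<in> P" for z
  proof -
    have "z - a \<noteq> 0" using that notin_domain by auto
    then have "of_nat p * ?W z / (z - a) = of_nat p * (z - a) ^ (p - Suc 0)"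
      by (cases p) auto
    then show ?thesis by (auto intro!: derivative_eq_intros)
  qed
  have d: "\<forall>\<^sub>F z in at a within P. deriv (\<Phi> (Suc q)) z = \<Phi> q z"
  proof (rule deriv_primitive[OF W W0 _ \<Phi>])
    show "(of_nat (Suc l) + of_nat p) * \<kappa> (Suc l) = - \<kappa> l" for l
      using \<kappa>[of l] by (simp only: of_nat_add)
  qed
  have "\<forall>\<^sub>F z in at a within P.
      (\<lambda>l. primitive_coeff \<kappa> u (Suc q) l * (z - a) ^ l) sums (\<Phi> (Suc q) z / ?W z)"
    using \<Phi>[of "Suc q"] eventually_domain
  proof eventually_elim
    case (elim z)
    then show ?case
      using sums_divide[OF elim(1), of "?W z"] W0[of z] by simp
  qed
  then obtain h where h: "h analytic_on {a}" "h a = primitive_coeff \<kappa> u (Suc q) 0"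
    "\<forall>\<^sub>F z in at a within P. \<Phi> (Suc q) z / ?W z = h z"
    by (rule power_series_near)
  have "(\<lambda>z. ?W z * h z) analytic_on {a}" using h(1) by (intro analytic_intros)
  moreover have "\<forall>\<^sub>F z in at a within P. \<Phi> (Suc q) z = ?W z * h z"
    using h(3) eventually_domain by eventually_elim (use W0 in \<open>auto simp: field_simps\<close>)
  ultimately show ?thesis
    using deriv_log_times[OF L hol d, of "\<lambda>z. ?W z * h z"] by (simp add: h(2) primitive_coeff_def)
qed

end

section \<open>The functions hat Psi and their primitives and derivatives\<close>

text \<open>Positive \<open>m\<close> counts derivatives and negative \<open>m\<close> primitives of the series with \<open>m = 0\<close>; the
  first \<open>- m\<close> coefficients of a primitive vanish.\<close>

definition hat_coeff :: "nat \<Rightarrow> (nat \<Rightarrow> complex) \<Rightarrow> int \<Rightarrow> nat \<Rightarrow> complex" where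
  "hat_coeff N u m l =
     (if int l + m < 0 then 0 else (- 1) ^ (nat (int l + m) + N) / fact l * u (nat (int l + m)))"

text \<open>The factorial absorbs the factor from differentiation, and sign and coefficient depend
  only on \<open>l + m\<close>. Differentiation is therefore a shift of \<open>m\<close>, uniformly
  for primitives and derivatives.\<close>

lemma diffs_hat_coeff: "diffs (hat_coeff N u m) = hat_coeff N u (m + 1)"
proof
  fix l
  have "of_nat (Suc l) * (x / fact (Suc l)) = x / fact l" for x :: complex
    by (simp add: fact_Suc del: of_nat_Suc)
  then have "of_nat (Suc l) * (x / fact (Suc l) * y) = x / fact l * y" for x y :: complex
    by (metis mult.assoc)
  moreover have "int (Suc l) + m = int l + (m + 1)" by simp
  ultimately show "diffs (hat_coeff N u m) l = hat_coeff N u (m + 1) l"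
    unfolding diffs_def hat_coeff_def by (simp only: if_distrib[of "\<lambda>x. _ * x"] mult_zero_right)
qed

text \<open>One scalar component of the hat functions at a branch point, with \<open>u\<close> the
  corresponding entries of the formal coefficients. Primitives are given by series and derivatives
  by differentiating \<open>H 0\<close>; the lemmas below bring both under one expansion.\<close>

locale hat_family = cut_point +
  fixes N :: nat and u :: "nat \<Rightarrow> complex" and H :: "int \<Rightarrow> complex \<Rightarrow> complex"
  assumes holomorphic_primitive: "\<And>q. H (- int q) holomorphic_on P"
    and primitive_series: "\<And>q. \<forall>\<^sub>F z in at a within P.
          (\<lambda>l. (if l < q then 0 else (- 1) ^ q * (- 1) ^ (l + N) / fact l * (z - a) ^ l * u (l - q)))
            sums H (- int q) z"
    and higher_deriv: "\<And>r z. z \<in> P \<Longrightarrow> H (int r) z = (deriv ^^ r) (H 0) z"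
begin

lemma holomorphic: "H m holomorphic_on P"
proof (cases m)
  case (nonneg r)
  have "(deriv ^^ r) (H 0) holomorphic_on P"
    using holomorphic_primitive[of 0] open_domain by (intro holomorphic_higher_deriv) auto
  then show ?thesis
    using higher_deriv nonneg by (subst holomorphic_cong[OF refl]) auto
next
  case (neg q)
  then show ?thesis using holomorphic_primitive[of "Suc q"] by simp
qed

lemma deriv_nonneg:
  assumes "z \<in> P" shows "deriv (H (int r)) z = H (int (Suc r)) z"
proof -
  have "\<forall>\<^sub>F w in nhds z. w \<in> P" using open_domain assms by (rule eventually_nhds_in_open)
  then have "\<forall>\<^sub>F w in nhds z. H (int r) w = (deriv ^^ r) (H 0) w"
    by eventually_elim (rule higher_deriv)
  then have "deriv (H (int r)) z = deriv ((deriv ^^ r) (H 0)) z"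
    by (rule deriv_cong_ev) simp
  then show ?thesis using higher_deriv[OF assms, of "Suc r"] by simp
qed

lemma series: "\<forall>\<^sub>F z in at a within P. (\<lambda>l. hat_coeff N u m l * (z - a) ^ l) sums H m z"
proof -
  have neg: "\<forall>\<^sub>F z in at a within P. (\<lambda>l. hat_coeff N u (- int q) l * (z - a) ^ l) sums H (- int q) z" for q
  proof -
    have "hat_coeff N u (- int q) l * x =
        (if l < q then 0 else (- 1) ^ q * (- 1) ^ (l + N) / fact l * x * u (l - q))" for l x
    proof (cases "l < q")
      case False
      \<comment> \<open>In terms of \<open>m\<close> the two sign factors contain
        \<open>(-1) ^ q\<close> twice, leaving the sign \<open>(-1) ^ (m + N)\<close> of
        \<open>hat_coeff\<close>.\<close>
      then obtain m where "l = q + m" by (metis le_Suc_ex not_less)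
      then show ?thesis by (simp add: hat_coeff_def power_add mult.assoc flip: power_mult_distrib)
    qed (simp add: hat_coeff_def)
    then show ?thesis using primitive_series[of q] by simp
  qed
  have "\<forall>\<^sub>F z in at a within P. (\<lambda>l. hat_coeff N u (int r) l * (z - a) ^ l) sums H (int r) z" for r
  proof (induction r)
    case 0
    show ?case using neg[of 0] by simp
  next
    case (Suc r)
    have *: "int r + 1 = int (Suc r)" by simp
    from sums_deriv[OF Suc] eventually_domain show ?case
    proof eventually_elim
      case (elim z)
      then show ?case using deriv_nonneg[of z r] unfolding diffs_hat_coeff * by simp
    qed
  qed
  then show ?thesis using neg by (cases m) (simp_all only: int_cases)
qed

lemma eventually_deriv: "\<forall>\<^sub>F z in at a within P. deriv (H m) z = H (m + 1) z"
  using sums_deriv[OF series[of m]] series[of "m + 1"]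
  by eventually_elim (simp only: diffs_hat_coeff sums_unique2)

text \<open>The correction that makes \<open>L z * H (int N + 1 - int q) z + polar_part q z\<close> a primitive of
  the same expression with \<open>q - 1\<close>; for \<open>q > N\<close> the truncated subtraction makes the sum empty.\<close>

definition polar_part :: "nat \<Rightarrow> complex \<Rightarrow> complex" where
  "polar_part q z = (- 1) ^ q * (\<Sum>l<Suc N - q. fact (N - q - l) * u l / (z - a) ^ (Suc N - q - l))"

text \<open>Each term of \<open>polar_part (Suc q)\<close> differentiates to the term of
  \<open>polar_part q\<close> with the same \<open>l\<close>. The last term of the latter,
  \<open>l = N - q\<close>, is a simple pole without a rational primitive; it is what has to be
  subtracted.\<close>

lemma has_field_derivative_polar_part:
  assumes "z \<noteq> a"
  shows "(polar_part (Suc q) has_field_derivative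
           polar_part q z - (if q \<le> N then (- 1) ^ q * u (N - q) / (z - a) else 0)) (at z)"
proof (cases "q \<le> N")
  case True
  define M where "M = N - q"
  have M: "Suc N - q = Suc M" "N - q = M" "Suc N - Suc q = M" "N - Suc q = M - 1"
    using True by (auto simp: M_def)
  have "((\<lambda>z. fact (M - 1 - l) * u l / (z - a) ^ (M - l)) has_field_derivative
         - (fact (M - l) * u l / (z - a) ^ (Suc M - l))) (at z)" if "l < M" for l
  proof -
    obtain m where m: "M - l = Suc m" "M - 1 - l = m" "Suc M - l = Suc (Suc m)"
      using \<open>l < M\<close> by (metis Suc_diff_Suc Suc_diff_le diff_Suc_eq_diff_pred less_imp_le_nat diff_commute One_nat_def diff_Suc_1)
    have "((\<lambda>z. z - a) has_field_derivative 1) (at z)"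
      by (auto intro!: derivative_eq_intros)
    then have "((\<lambda>z. fact m * u l / (z - a) ^ Suc m) has_field_derivative
        (0 * (z - a) ^ Suc m - fact m * u l * ((1 + of_nat m) * (1 * (z - a) ^ m)))
          / ((z - a) ^ Suc m * (z - a) ^ Suc m)) (at z)"
      using assms by (intro DERIV_divide DERIV_const DERIV_power_Suc) simp_all
    also have "(0 * (z - a) ^ Suc m - fact m * u l * ((1 + of_nat m) * (1 * (z - a) ^ m)))
          / ((z - a) ^ Suc m * (z - a) ^ Suc m) = - (fact (Suc m) * u l / (z - a) ^ Suc (Suc m))"
      using assms by (simp add: divide_simps)
    finally show ?thesis unfolding m .
  qed
  then have "((\<lambda>z. (- 1) ^ Suc q * (\<Sum>l<M. fact (M - 1 - l) * u l / (z - a) ^ (M - l)))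
      has_field_derivative (- 1) ^ Suc q * (\<Sum>l<M. - (fact (M - l) * u l / (z - a) ^ (Suc M - l)))) (at z)"
    by (intro DERIV_cmult DERIV_sum) auto
  moreover have "polar_part (Suc q) = (\<lambda>z. (- 1) ^ Suc q * (\<Sum>l<M. fact (M - 1 - l) * u l / (z - a) ^ (M - l)))"
    by (rule ext) (simp only: polar_part_def M)
  moreover have "(- 1) ^ Suc q * (\<Sum>l<M. - (fact (M - l) * u l / (z - a) ^ (Suc M - l)))
      = polar_part q z - (if q \<le> N then (- 1) ^ q * u (N - q) / (z - a) else 0)"
    using True by (simp add: polar_part_def M sum_negf algebra_simps)
  ultimately show ?thesis by simp
next
  case False
  then have "polar_part (Suc q) = (\<lambda>_. 0)" "polar_part q z = 0"
    by (auto simp: polar_part_def)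
  then show ?thesis using False by simp
qed

lemma holomorphic_polar_part: "polar_part q holomorphic_on P"
  unfolding polar_part_def[abs_def] using notin_domain by (intro holomorphic_intros) auto

text \<open>Differentiating the logarithm yields a simple pole whose residue is the constant
  coefficient of \<open>H (int N - int q)\<close>. This is exactly the pole missing from the
  derivative of \<open>polar_part (Suc q)\<close>; for \<open>q > N\<close> both are zero.\<close>

lemma log_hat_step:
  assumes L: "\<And>z. z \<in> P \<Longrightarrow> (L has_field_derivative 1 / (z - a)) (at z)"
  shows "eq_mod_analytic P a
           (deriv (\<lambda>z. L z * H (int N + 1 - int (Suc q)) z + polar_part (Suc q) z))
           (\<lambda>z. L z * H (int N + 1 - int q) z + polar_part q z)"
proof -
  define m where "m = int N - int q"
  have m: "int N + 1 - int (Suc q) = m" "int N + 1 - int q = m + 1" by (simp_all add: m_def)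
  define R where "R = (if q \<le> N then (- 1) ^ q * u (N - q) else 0)"
  have c0: "hat_coeff N u m 0 = R"
  proof (cases "q \<le> N")
    case True
    \<comment> \<open>The sign in \<open>hat_coeff\<close> at \<open>l = 0\<close> has exponent
      \<open>2 * N - q\<close>, which has the parity of \<open>q\<close>.\<close>
    then have "even (N - q + N) \<longleftrightarrow> even q" by presburger
    then have "(- 1 :: complex) ^ (N - q + N) = (- 1) ^ q"
      by (simp only: minus_one_power_iff)
    then show ?thesis using True by (simp add: hat_coeff_def m_def R_def nat_diff_distrib)
  qed (simp add: hat_coeff_def m_def R_def)
  obtain h where h: "h analytic_on {a}" "h a = R" "\<forall>\<^sub>F z in at a within P. H m z = h z"
    by (rule power_series_near[OF series[of m]]) (use c0 in auto)
  have L': "L holomorphic_on P" using L open_domain by (subst holomorphic_on_open) blast+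
  have "\<forall>\<^sub>F z in at a within P. deriv (\<lambda>z. L z * H m z + polar_part (Suc q) z) z
      = deriv (\<lambda>z. L z * H m z) z + (polar_part q z - R / (z - a))"
    using eventually_domain
  proof eventually_elim
    case (elim z)
    then have "((\<lambda>z. L z * H m z) has_field_derivative deriv (\<lambda>z. L z * H m z) z) (at z)"
      using L' holomorphic open_domain by (intro holomorphic_derivI[OF _ open_domain] holomorphic_intros) auto
    moreover have "(polar_part (Suc q) has_field_derivative polar_part q z - R / (z - a)) (at z)"
      using has_field_derivative_polar_part[of z q] elim by (cases "q \<le> N") (auto simp: R_def)
    ultimately show ?case by (intro DERIV_imp_deriv DERIV_add)
  qed
  then have "eq_mod_analytic P a (deriv (\<lambda>z. L z * H m z + polar_part (Suc q) z))
      (\<lambda>z. deriv (\<lambda>z. L z * H m z) z + (polar_part q z - R / (z - a)))"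
    by (rule eq_mod_analyticI)
  also have "eq_mod_analytic P a \<dots> (\<lambda>z. (L z * H (m + 1) z + h a / (z - a)) + (polar_part q z - R / (z - a)))"
    by (rule eq_mod_analytic_add[OF deriv_log_times[OF L holomorphic eventually_deriv h(1,3)] eq_mod_analytic_refl])
  finally show ?thesis unfolding m by (simp add: h(2))
qed

end

section \<open>Behaviour at the other branch points\<close>

lemma cut_point_cut_plane:
  assumes "inj lam" and "admissible lam \<eta>"
  shows "cut_point (cut_plane lam \<eta>) (lam j)"
proof
  show "open (cut_plane lam \<eta>)" by (rule open_cut_plane)
  show "lam j \<notin> cut_plane lam \<eta>" by (rule branch_point_notin_cut_plane)
  obtain d where d: "d > 0" "\<And>e. e \<le> d \<Longrightarrow> ball (lam j) e \<inter> cut_plane lam \<eta>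
      = ball (lam j) e \<inter> {z. (z - lam j) * cis (pi - \<eta>) \<notin> \<real>\<^sub>\<le>\<^sub>0}"
    by (rule cut_plane_near_branch_point[OF assms]) blast
  show "\<exists>d>0. \<forall>e. 0 < e \<and> e \<le> d \<longrightarrow>
      connected (ball (lam j) e \<inter> cut_plane lam \<eta>) \<and> ball (lam j) e \<inter> cut_plane lam \<eta> \<noteq> {}"
    using d(1) by (intro exI[of _ d]) (simp add: d(2) connected_slit_ball)
qed

lemma continues_series_component:
  fixes f :: "complex \<Rightarrow> complex^'n::finite"
  assumes "continues_series P a s f"
  shows "(\<lambda>z. f z $ i) holomorphic_on P"
    and "\<forall>\<^sub>F z in at a within P. (\<lambda>l. s z l $ i) sums (f z $ i)"
proof -
  show "(\<lambda>z. f z $ i) holomorphic_on P"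
    using assms by (auto simp: continues_series_def vec_holomorphic_on_def)
  have "\<forall>\<^sub>F z in at a within P. s z sums f z"
    using assms by (auto simp: continues_series_def)
  then show "\<forall>\<^sub>F z in at a within P. (\<lambda>l. s z l $ i) sums (f z $ i)"
    by eventually_elim (rule bounded_linear.sums[OF bounded_linear_vec_nth])
qed

lemma hat_family_component:
  fixes F :: "nat \<Rightarrow> complex^'n::finite^'n" and H :: "int \<Rightarrow> complex \<Rightarrow> complex^'n"
  assumes "inj lam" and "admissible lam \<eta>" and H: "is_hat_Psi lam F \<eta> k N H"
  shows "hat_family (cut_plane lam \<eta>) (lam k) N (\<lambda>l. F l $ i $ k) (\<lambda>m z. H m z $ i)"
proof -
  interpret cut_point "cut_plane lam \<eta>" "lam k"
    by (rule cut_point_cut_plane[OF assms(1,2)])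
  show ?thesis
  proof
    fix q
    have c: "continues_series (cut_plane lam \<eta>) (lam k)
        (\<lambda>z l. if l < q then 0 else
                 ((- 1) ^ q * (- 1) ^ (l + N) / fact l * (z - lam k) ^ l) *s column k (F (l - q)))
        (H (- int q))"
      using H by (auto simp: is_hat_Psi_def)
    show "(\<lambda>z. H (- int q) z $ i) holomorphic_on cut_plane lam \<eta>"
      by (rule continues_series_component(1)[OF c])
    show "\<forall>\<^sub>F z in at (lam k) within cut_plane lam \<eta>.
        (\<lambda>l. if l < q then 0 else (- 1) ^ q * (- 1) ^ (l + N) / fact l * (z - lam k) ^ l * F (l - q) $ i $ k)
          sums (H (- int q) z $ i)"
      using continues_series_component(2)[OF c, of i]
      by eventually_elim (simp add: column_def if_distrib[of "\<lambda>x. x $ i"] cong: if_cong)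
  next
    fix r z assume "z \<in> cut_plane lam \<eta>"
    then show "H (int r) z $ i = (deriv ^^ r) (\<lambda>z. H 0 z $ i) z"
      using H by (simp add: is_hat_Psi_def vec_nderiv_def)
  qed
qed

text \<open>The two sides have the same expansion at the branch point and agree everywhere because the
  cut plane is connected.\<close>

lemma Psi_eq_deriv_hat:
  fixes A1 :: "complex^'n::finite^'n" and \<Psi> :: "complex \<Rightarrow> complex^'n"
    and H :: "int \<Rightarrow> complex \<Rightarrow> complex^'n"
  assumes "inj lam" and "admissible lam \<eta>"
    and \<Psi>: "is_Psi lam A1 F \<eta> k \<Psi>" and H: "is_hat_Psi lam F \<eta> k N H"
    and N: "A1 $ k $ k = of_nat N" and z: "z \<in> cut_plane lam \<eta>"
  shows "\<Psi> z $ i = H (int N + 1) z $ i"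
proof -
  interpret hat_family "cut_plane lam \<eta>" "lam k" N "\<lambda>l. F l $ i $ k" "\<lambda>m z. H m z $ i"
    by (rule hat_family_component[OF assms(1,2) H])
  let ?P = "cut_plane lam \<eta>"
  have c: "continues_series ?P (lam k)
          (\<lambda>z l. ((- 1) ^ (l + 1) / fact l * (z - lam k) ^ l) *s column k (F (N + l + 1))) \<Psi>"
    using \<Psi> N by (auto simp: is_Psi_def)
  have "\<forall>\<^sub>F z in at (lam k) within ?P. \<Psi> z $ i = H (int N + 1) z $ i"
    using continues_series_component(2)[OF c, of i] series[of "int N + 1"]
  proof eventually_elim
    case (elim z)
    have "hat_coeff N (\<lambda>l. F l $ i $ k) (int N + 1) l * (z - lam k) ^ l
        = (((- 1) ^ (l + 1) / fact l * (z - lam k) ^ l) *s column k (F (N + l + 1))) $ i" for l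
    proof -
      have "nat (int l + (int N + 1)) = N + l + 1" by simp
      \<comment> \<open>The normalizing sign \<open>(-1) ^ N\<close> of the hat function and the
        \<open>N\<close> in the index shift cancel in parity, leaving the sign in the expansion of
        \<open>\<Psi>\<close>.\<close>
      moreover have "(- 1 :: complex) ^ (N + l + 1 + N) = (- 1) ^ (l + 1)"
        by (simp add: minus_one_power_iff)
      ultimately show ?thesis by (simp add: hat_coeff_def column_def)
    qed
    then show ?case using sums_unique2 elim by (simp only:)
  qed
  then obtain d where d: "d > 0"
    "\<forall>e. 0 < e \<and> e \<le> d \<longrightarrow> connected (ball (lam k) e \<inter> ?P) \<and> ball (lam k) e \<inter> ?P \<noteq> {}"
    "\<forall>z\<in>ball (lam k) d \<inter> ?P. \<Psi> z $ i = H (int N + 1) z $ i"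
    by (rule eventually_near)
  show ?thesis
  proof (rule analytic_continuation_open[of "ball (lam k) d \<inter> ?P" ?P "\<lambda>z. \<Psi> z $ i"
      "\<lambda>z. H (int N + 1) z $ i"])
    show "(\<lambda>z. \<Psi> z $ i) holomorphic_on ?P" by (rule continues_series_component(1)[OF c])
    show "(\<lambda>z. H (int N + 1) z $ i) holomorphic_on ?P" by (rule holomorphic)
    show "connected ?P" by (rule connected_cut_plane)
    show "ball (lam k) d \<inter> ?P \<noteq> {}" using d(1,2) by blast
  qed (use d(3) open_domain z in auto)
qed

theorem corollary8:
  fixes lam :: "'n::finite \<Rightarrow> complex"
    and A1 :: "complex^'n^'n"
    and \<eta> :: real
    and F :: "nat \<Rightarrow> complex^'n^'n"
    and \<Psi> \<Psi>sing :: "'n \<Rightarrow> complex \<Rightarrow> complex^'n"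
    and \<Psi>prim :: "'n \<Rightarrow> nat \<Rightarrow> complex \<Rightarrow> complex^'n"
    and \<Psi>hat :: "'n \<Rightarrow> int \<Rightarrow> complex \<Rightarrow> complex^'n"
    and c :: "'n \<Rightarrow> 'n \<Rightarrow> complex"
    and k :: 'n and Nk :: nat
  assumes "inj lam"
    and "admissible lam \<eta>"
    and "\<And>j. A1 $ j $ j = - 1 \<Longrightarrow> has_nontrivial_jordan_block (residue_F A1 j)"
    and "formal_solution_R (diagonal_matrix lam) A1 F"
    and "\<And>j. is_Psi lam A1 F \<eta> j (\<Psi> j)"
    and "\<And>j. is_Psi_sing lam A1 F \<eta> j (\<Psi> j) (\<Psi>sing j)"
    and "is_connection_coeffs lam A1 \<eta> \<Psi> \<Psi>sing c"
    and "\<And>j q. is_Psi_primitive lam A1 F \<eta> j q (\<Psi>prim j q)"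
    and "\<And>j N. A1 $ j $ j = of_nat N \<Longrightarrow> is_hat_Psi lam F \<eta> j N (\<Psi>hat j)"
    and "A1 $ k $ k = of_nat Nk"
  shows "\<forall>j. j \<noteq> k \<longrightarrow>
    (A1 $ j $ j \<notin> \<int> \<longrightarrow>
       eq_mod_reg (cut_plane lam \<eta>) (lam j) (\<Psi>hat k 0)
         (\<lambda>z. c j k *s \<Psi>prim j (Nk + 1) z)) \<and>
    (\<forall>Nj::nat. A1 $ j $ j = of_nat Nj \<longrightarrow>
       (Nj \<ge> Nk + 1 \<longrightarrow>
          eq_mod_reg (cut_plane lam \<eta>) (lam j) (\<Psi>hat k 0)
            (\<lambda>z. c j k *s
               (branch_ln \<eta> (z - lam j) *s \<Psi>hat j (int Nj - int Nk) z
                + (1 / (z - lam j) ^ (Nj - Nk)) *s polar_poly lam F j Nj Nk z))) \<and>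
       (Nk \<ge> Nj \<longrightarrow>
          eq_mod_reg (cut_plane lam \<eta>) (lam j) (\<Psi>hat k 0)
            (\<lambda>z. c j k *s (branch_ln \<eta> (z - lam j) *s \<Psi>hat j (int Nj - int Nk) z)))) \<and>
    (\<forall>Nj::int. A1 $ j $ j = of_int Nj \<and> Nj < 0 \<longrightarrow>
       eq_mod_reg (cut_plane lam \<eta>) (lam j) (\<Psi>hat k 0)
         (\<lambda>z. c j k *s (branch_ln \<eta> (z - lam j) *s \<Psi>prim j (Nk + 1) z)))"
proof (intro allI impI)
  fix j assume "j \<noteq> k"
  let ?P = "cut_plane lam \<eta>"
  let ?L = "\<lambda>z. branch_ln \<eta> (z - lam j)"
  note cp = assms(1,2) and \<Psi> = assms(5) and sing = assms(6) and conn = assms(7)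
    and prim = assms(8) and hat = assms(9) and Nk = assms(10)
  interpret cut_point ?P "lam j" by (rule cut_point_cut_plane[OF cp])
  have L: "(?L has_field_derivative 1 / (z - lam j)) (at z)" if "z \<in> ?P" for z
    using that by (rule has_field_derivative_branch_ln)
  note holL = holomorphic_on_branch_ln[of \<eta> lam j]

  \<comment> \<open>The common reduction of all cases to a chain \<open>G\<close> of successive
    primitives. The condition on \<open>G 0\<close> retains the factor \<open>c j k\<close>, so that
    it also covers a zero coefficient for which no logarithmic solution is available.\<close>
  have transfer: "eq_mod_analytic ?P (lam j) (\<lambda>z. \<Psi>hat k 0 z $ i) (\<lambda>z. c j k * G (Nk + 1) z)"
    if G: "\<And>q. G q holomorphic_on ?P"
      and dG: "\<And>q. eq_mod_analytic ?P (lam j) (deriv (G (Suc q))) (G q)"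
      and G0: "eq_mod_analytic ?P (lam j) (\<lambda>z. c j k * \<Psi>sing j z $ i) (\<lambda>z. c j k * G 0 z)"
    for i G
  proof (rule eq_mod_analytic_of_higher_deriv[where G = G, OF G dG])
    interpret k: hat_family ?P "lam k" Nk "\<lambda>l. F l $ i $ k" "\<lambda>m z. \<Psi>hat k m z $ i"
      by (rule hat_family_component[OF cp hat[OF Nk]])
    show "(\<lambda>z. \<Psi>hat k 0 z $ i) holomorphic_on ?P" by (rule k.holomorphic)
    have "\<forall>\<^sub>F z in at (lam j) within ?P.
        (deriv ^^ (Nk + 1)) (\<lambda>z. \<Psi>hat k 0 z $ i) z = \<Psi> k z $ i"
      using eventually_domain
    proof eventually_elim
      case (elim z)
      then show ?case
        using Psi_eq_deriv_hat[OF cp \<Psi> hat[OF Nk] Nk, of z i] k.higher_deriv[of z "Nk + 1"]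
        by (simp add: add.commute)
    qed
    then have "eq_mod_analytic ?P (lam j) ((deriv ^^ (Nk + 1)) (\<lambda>z. \<Psi>hat k 0 z $ i)) (\<lambda>z. \<Psi> k z $ i)"
      by (rule eq_mod_analyticI)
    also have "eq_mod_analytic ?P (lam j) (\<lambda>z. \<Psi> k z $ i) (\<lambda>z. c j k * \<Psi>sing j z $ i)"
      using conn unfolding is_connection_coeffs_def eq_mod_reg_iff_components
        vector_smult_component by blast
    also note G0
    finally show "eq_mod_analytic ?P (lam j) ((deriv ^^ (Nk + 1)) (\<lambda>z. \<Psi>hat k 0 z $ i)) (\<lambda>z. c j k * G 0 z)" .
  qed

  show "(A1 $ j $ j \<notin> \<int> \<longrightarrow>
       eq_mod_reg ?P (lam j) (\<Psi>hat k 0) (\<lambda>z. c j k *s \<Psi>prim j (Nk + 1) z)) \<and>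
    (\<forall>Nj::nat. A1 $ j $ j = of_nat Nj \<longrightarrow>
       (Nj \<ge> Nk + 1 \<longrightarrow>
          eq_mod_reg ?P (lam j) (\<Psi>hat k 0)
            (\<lambda>z. c j k *s
               (branch_ln \<eta> (z - lam j) *s \<Psi>hat j (int Nj - int Nk) z
                + (1 / (z - lam j) ^ (Nj - Nk)) *s polar_poly lam F j Nj Nk z))) \<and>
       (Nk \<ge> Nj \<longrightarrow>
          eq_mod_reg ?P (lam j) (\<Psi>hat k 0)
            (\<lambda>z. c j k *s (branch_ln \<eta> (z - lam j) *s \<Psi>hat j (int Nj - int Nk) z)))) \<and>
    (\<forall>Nj::int. A1 $ j $ j = of_int Nj \<and> Nj < 0 \<longrightarrow>
       eq_mod_reg ?P (lam j) (\<Psi>hat k 0)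
         (\<lambda>z. c j k *s (branch_ln \<eta> (z - lam j) *s \<Psi>prim j (Nk + 1) z)))"
  proof (intro conjI allI impI)

    \<comment> \<open>Branch points with nonintegral exponent\<close>
    assume nonint: "A1 $ j $ j \<notin> \<int>"
    \<comment> \<open>The exponent of the leading term of \<open>\<Psi> j\<close>; all exponents
      differ from it by natural numbers.\<close>
    define e where "e = - A1 $ j $ j - 1"
    define \<kappa> where "\<kappa> l = Gamma (A1 $ j $ j + 1 - of_nat l)" for l
    have cs: "continues_series ?P (lam j)
          (\<lambda>z l. if l < q then 0 else
                   ((- 1) ^ q * Gamma (A1 $ j $ j + 1 - of_nat l)
                     * branch_powr \<eta> (z - lam j) (of_nat l - A1 $ j $ j - 1)) *s column j (F (l - q))) (\<Psi>prim j q)" for q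
      using prim[of j q] nonint by (auto simp: is_Psi_primitive_def)
    have cs0: "continues_series ?P (lam j)
          (\<lambda>z l. (Gamma (A1 $ j $ j + 1 - of_nat l)
                   * branch_powr \<eta> (z - lam j) (of_nat l - A1 $ j $ j - 1)) *s column j (F l)) (\<Psi> j)"
      using \<Psi>[of j] nonint by (auto simp: is_Psi_def)
    have powr: "branch_powr \<eta> (z - lam j) (of_nat l - A1 $ j $ j - 1)
        = (z - lam j) ^ l * branch_powr \<eta> (z - lam j) e" if "z \<noteq> lam j" for z l
      using branch_powr_of_nat_add[of "z - lam j" \<eta> l e] that by (simp add: e_def algebra_simps)
    have "eq_mod_analytic ?P (lam j) (\<lambda>z. \<Psi>hat k 0 z $ i) (\<lambda>z. c j k * \<Psi>prim j (Nk + 1) z $ i)" for i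
    proof (rule transfer)
      show "(\<lambda>z. \<Psi>prim j q z $ i) holomorphic_on ?P" for q
        by (rule continues_series_component(1)[OF cs])
      have series: "\<forall>\<^sub>F z in at (lam j) within ?P.
          (\<lambda>l. branch_powr \<eta> (z - lam j) e *
              (primitive_coeff \<kappa> (\<lambda>l. F l $ i $ j) q l * (z - lam j) ^ l)) sums (\<Psi>prim j q z $ i)" for q
        using continues_series_component(2)[OF cs[of q], of i] eventually_domain
      proof eventually_elim
        case (elim z)
        then have "(\<lambda>l. (if l < q then 0 else ((- 1) ^ q * Gamma (A1 $ j $ j + 1 - of_nat l)
              * branch_powr \<eta> (z - lam j) (of_nat l - A1 $ j $ j - 1)) *s column j (F (l - q))) $ i)
            = (\<lambda>l. branch_powr \<eta> (z - lam j) e *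
              (primitive_coeff \<kappa> (\<lambda>l. F l $ i $ j) q l * (z - lam j) ^ l))"
          by (intro ext) (simp add: powr primitive_coeff_def \<kappa>_def column_def)
        with elim show ?case by (simp only:)
      qed
      \<comment> \<open>This is the functional equation of Gamma at a point that is nonintegral,
        hence not a pole.\<close>
      have \<kappa>: "(of_nat (Suc l) + e) * \<kappa> (Suc l) = - \<kappa> l" for l
      proof -
        have "A1 $ j $ j - of_nat l \<notin> \<int>\<^sub>\<le>\<^sub>0"
          using nonint by (metis Ints_of_nat Ints_add diff_add_cancel nonpos_Ints_Int)
        from Gamma_plus1[OF this] show ?thesis by (simp add: e_def \<kappa>_def algebra_simps)
      qed
      have "\<forall>\<^sub>F z in at (lam j) within ?P.
          deriv (\<lambda>z. \<Psi>prim j (Suc q) z $ i) z = \<Psi>prim j q z $ i" for q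
      proof (rule deriv_primitive[OF _ _ \<kappa> series])
        show "((\<lambda>z. branch_powr \<eta> (z - lam j) e) has_field_derivative
            e * branch_powr \<eta> (z - lam j) e / (z - lam j)) (at z)" if "z \<in> ?P" for z
          using that by (rule has_field_derivative_branch_powr)
      qed (simp add: branch_powr_def)
      then show "eq_mod_analytic ?P (lam j) (deriv (\<lambda>z. \<Psi>prim j (Suc q) z $ i)) (\<lambda>z. \<Psi>prim j q z $ i)" for q
        by (rule eq_mod_analyticI)
      have "\<forall>\<^sub>F z in at (lam j) within ?P. \<Psi>sing j z $ i = \<Psi>prim j 0 z $ i"
        using continues_series_component(2)[OF cs[of 0], of i]
          continues_series_component(2)[OF cs0, of i] eventually_domain
      proof eventually_elim
        case (elim z)
        have "\<Psi>sing j z = \<Psi> j z"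
          using sing[of j] nonint elim by (auto simp: is_Psi_sing_def)
        moreover have "\<Psi>prim j 0 z $ i = \<Psi> j z $ i"
          using elim(1,2) by (simp add: sums_iff)
        ultimately show ?case by simp
      qed
      then show "eq_mod_analytic ?P (lam j) (\<lambda>z. c j k * \<Psi>sing j z $ i) (\<lambda>z. c j k * \<Psi>prim j 0 z $ i)"
        by (intro eq_mod_analyticI) (auto elim: eventually_mono)
    qed
    then show "eq_mod_reg ?P (lam j) (\<Psi>hat k 0) (\<lambda>z. c j k *s \<Psi>prim j (Nk + 1) z)"
      by (simp add: eq_mod_reg_iff_components mult.assoc)
  next

    \<comment> \<open>Branch points with negative integral exponent\<close>
    fix M :: int assume M: "A1 $ j $ j = of_int M \<and> M < 0"
    \<comment> \<open>The lowest exponent in the expansion of \<open>\<Psi> j\<close>; it is 0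
      exactly when \<open>M = - 1\<close>.\<close>
    define p where "p = nat (- M - 1)"
    define \<kappa> :: "nat \<Rightarrow> complex" where "\<kappa> l = (- 1) ^ (l + p + 1) / fact (l + p)" for l
    have p: "nat (int l - M) = l + p + 1" "nat (int l - M - 1) = l + p" for l
      using M by (auto simp: p_def)
    have cs: "continues_series ?P (lam j)
          (\<lambda>z l. if l < q then 0 else
                   ((- 1) ^ q * (- 1) ^ nat (int l - M) / fact (nat (int l - M - 1))
                     * (z - lam j) ^ nat (int l - M - 1)) *s column j (F (l - q))) (\<Psi>prim j q)" for q
      using prim[of j q] M unfolding is_Psi_primitive_def by blast
    have cs0: "continues_series ?P (lam j)
          (\<lambda>z l. ((- 1) ^ nat (int l - M) / fact (nat (int l - M - 1))
                   * (z - lam j) ^ nat (int l - M - 1)) *s column j (F l)) (\<Psi> j)"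
      using \<Psi>[of j] M unfolding is_Psi_def by blast
    \<comment> \<open>For \<open>M = - 1\<close> a logarithmic singular solution is given. For
      smaller \<open>M\<close> it may fail to exist; then \<open>\<Psi>sing j\<close> is zero and
      the convention makes \<open>c j k\<close> zero as well.\<close>
    have sing_cases: "log_solution_neg lam A1 \<eta> j (\<Psi> j) (\<Psi>sing j) \<or> c j k = 0"
    proof (cases "M = - 1")
      case True
      then show ?thesis using sing[of j] M by (auto simp: is_Psi_sing_def)
    next
      case False
      then have M2: "A1 $ j $ j = of_int M \<and> M \<le> - 2" using M by auto
      then have "if \<exists>T. log_solution_neg lam A1 \<eta> j (\<Psi> j) T
         then log_solution_neg lam A1 \<eta> j (\<Psi> j) (\<Psi>sing j)
         else (\<forall>z\<in>?P. \<Psi>sing j z = 0)"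
        using sing[of j] unfolding is_Psi_sing_def by blast
      moreover have "c j k = 0" if "\<forall>z\<in>?P. \<Psi>sing j z = 0"
        using conn M2 that unfolding is_connection_coeffs_def by blast
      ultimately show ?thesis by (auto split: if_splits)
    qed
    have "eq_mod_analytic ?P (lam j) (\<lambda>z. \<Psi>hat k 0 z $ i)
        (\<lambda>z. c j k * (?L z * \<Psi>prim j (Nk + 1) z $ i))" for i
    proof (rule transfer)
      have hol: "(\<lambda>z. \<Psi>prim j q z $ i) holomorphic_on ?P" for q
        by (rule continues_series_component(1)[OF cs])
      show "(\<lambda>z. ?L z * \<Psi>prim j q z $ i) holomorphic_on ?P" for q
        using holL hol by (rule holomorphic_on_mult)
      show "eq_mod_analytic ?P (lam j) (deriv (\<lambda>z. ?L z * \<Psi>prim j (Suc q) z $ i))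
          (\<lambda>z. ?L z * \<Psi>prim j q z $ i)" for q
      proof (rule log_primitive[OF L hol])
        show "of_nat (Suc l + p) * \<kappa> (Suc l) = - \<kappa> l" for l
          by (simp add: \<kappa>_def fact_Suc del: of_nat_Suc)
        fix q
        show "\<forall>\<^sub>F z in at (lam j) within ?P.
          (\<lambda>l. (z - lam j) ^ p *
              (primitive_coeff \<kappa> (\<lambda>l. F l $ i $ j) q l * (z - lam j) ^ l)) sums (\<Psi>prim j q z $ i)"
          using continues_series_component(2)[OF cs[of q], of i]
        proof eventually_elim
          case (elim z)
          have "(\<lambda>l. (if l < q then 0 else
                   ((- 1) ^ q * (- 1) ^ nat (int l - M) / fact (nat (int l - M - 1))
                     * (z - lam j) ^ nat (int l - M - 1)) *s column j (F (l - q))) $ i)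
            = (\<lambda>l. (z - lam j) ^ p *
              (primitive_coeff \<kappa> (\<lambda>l. F l $ i $ j) q l * (z - lam j) ^ l))"
            by (intro ext) (simp add: p primitive_coeff_def \<kappa>_def column_def power_add)
          with elim show ?case by (simp only:)
        qed
      qed
      show "eq_mod_analytic ?P (lam j) (\<lambda>z. c j k * \<Psi>sing j z $ i)
          (\<lambda>z. c j k * (?L z * \<Psi>prim j 0 z $ i))"
        using sing_cases
      proof
        assume "log_solution_neg lam A1 \<eta> j (\<Psi> j) (\<Psi>sing j)"
        then have "eq_mod_analytic ?P (lam j) (\<lambda>z. \<Psi>sing j z $ i) (\<lambda>z. ?L z * \<Psi> j z $ i)"
          by (simp add: log_solution_neg_def eq_mod_reg_iff_components)
        also have "\<forall>\<^sub>F z in at (lam j) within ?P. ?L z * \<Psi> j z $ i = ?L z * \<Psi>prim j 0 z $ i"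
          using continues_series_component(2)[OF cs[of 0], of i]
            continues_series_component(2)[OF cs0, of i]
          by eventually_elim (simp add: sums_iff)
        then have "eq_mod_analytic ?P (lam j) (\<lambda>z. ?L z * \<Psi> j z $ i) (\<lambda>z. ?L z * \<Psi>prim j 0 z $ i)"
          by (rule eq_mod_analyticI)
        finally show ?thesis by (rule eq_mod_analytic_cmult)
      qed (simp add: eq_mod_analytic_refl)
    qed
    then show "eq_mod_reg ?P (lam j) (\<Psi>hat k 0)
         (\<lambda>z. c j k *s (branch_ln \<eta> (z - lam j) *s \<Psi>prim j (Nk + 1) z))"
      by (simp add: eq_mod_reg_iff_components mult.assoc)
  next

    \<comment> \<open>Branch points with natural exponent\<close>
    fix N :: nat assume N: "A1 $ j $ j = of_nat N"
    {
      fix i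
      interpret j: hat_family ?P "lam j" N "\<lambda>l. F l $ i $ j" "\<lambda>m z. \<Psi>hat j m z $ i"
        by (rule hat_family_component[OF cp hat[OF N]])
      \<comment> \<open>One chain serves both orderings of \<open>N\<close> and \<open>Nk\<close>:
        it starts from \<open>\<Psi>hat j (int N + 1)\<close>, which is \<open>\<Psi> j\<close>, and
        \<open>Nk + 1\<close> integrations lead to the index \<open>int N - int Nk\<close>.\<close>
      have "eq_mod_analytic ?P (lam j) (\<lambda>z. \<Psi>hat k 0 z $ i)
          (\<lambda>z. c j k * (?L z * \<Psi>hat j (int N + 1 - int (Nk + 1)) z $ i + j.polar_part (Nk + 1) z))"
      proof (rule transfer)
        show "(\<lambda>z. ?L z * \<Psi>hat j (int N + 1 - int q) z $ i + j.polar_part q z) holomorphic_on ?P" for q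
          by (intro holomorphic_on_add holomorphic_on_mult holL j.holomorphic j.holomorphic_polar_part)
        show "eq_mod_analytic ?P (lam j)
            (deriv (\<lambda>z. ?L z * \<Psi>hat j (int N + 1 - int (Suc q)) z $ i + j.polar_part (Suc q) z))
            (\<lambda>z. ?L z * \<Psi>hat j (int N + 1 - int q) z $ i + j.polar_part q z)" for q
          by (rule j.log_hat_step[OF L])
        have "log_solution_nat lam A1 F \<eta> j N (\<Psi> j) (\<Psi>sing j)"
          using sing[of j] N by (auto simp: is_Psi_sing_def)
        then have "eq_mod_analytic ?P (lam j) (\<lambda>z. \<Psi>sing j z $ i)
            (\<lambda>z. ?L z * \<Psi> j z $ i + 1 / (z - lam j) ^ (N + 1) *
                (\<Sum>l=0..N. fact (N - l) * (z - lam j) ^ l * F l $ i $ j))"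
          by (simp add: log_solution_nat_def eq_mod_reg_iff_components column_def)
        also have "\<forall>\<^sub>F z in at (lam j) within ?P. ?L z * \<Psi> j z $ i + 1 / (z - lam j) ^ (N + 1) *
                (\<Sum>l=0..N. fact (N - l) * (z - lam j) ^ l * F l $ i $ j)
              = ?L z * \<Psi>hat j (int N + 1 - int 0) z $ i + j.polar_part 0 z"
          using eventually_domain
        proof eventually_elim
          case (elim z)
          then have "1 / (z - lam j) ^ (N + 1) * (fact (N - l) * (z - lam j) ^ l * F l $ i $ j)
              = fact (N - 0 - l) * F l $ i $ j / (z - lam j) ^ (Suc N - 0 - l)" if "l < Suc N - 0" for l
            using that by (simp add: power_diff field_simps)
          then have "1 / (z - lam j) ^ (N + 1) * (\<Sum>l=0..N. fact (N - l) * (z - lam j) ^ l * F l $ i $ j)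
              = j.polar_part 0 z"
            unfolding j.polar_part_def sum_distrib_left power_0 mult_1_left
            by (intro sum.cong) auto
          moreover have "\<Psi> j z $ i = \<Psi>hat j (int N + 1) z $ i"
            using elim by (intro Psi_eq_deriv_hat[OF cp \<Psi> hat[OF N] N]) auto
          ultimately show ?case by simp
        qed
        then have "eq_mod_analytic ?P (lam j) (\<lambda>z. ?L z * \<Psi> j z $ i + 1 / (z - lam j) ^ (N + 1) *
                (\<Sum>l=0..N. fact (N - l) * (z - lam j) ^ l * F l $ i $ j))
            (\<lambda>z. ?L z * \<Psi>hat j (int N + 1 - int 0) z $ i + j.polar_part 0 z)"
          by (rule eq_mod_analyticI)
        finally show "eq_mod_analytic ?P (lam j) (\<lambda>z. c j k * \<Psi>sing j z $ i)
            (\<lambda>z. c j k * (?L z * \<Psi>hat j (int N + 1 - int 0) z $ i + j.polar_part 0 z))"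
          by (rule eq_mod_analytic_cmult)
      qed
    } note expansion = this
    {
      assume le: "Nk \<ge> N"
      have "eq_mod_analytic ?P (lam j) (\<lambda>z. \<Psi>hat k 0 z $ i)
          (\<lambda>z. c j k * (?L z * \<Psi>hat j (int N - int Nk) z $ i))" for i
      proof -
        interpret j: hat_family ?P "lam j" N "\<lambda>l. F l $ i $ j" "\<lambda>m z. \<Psi>hat j m z $ i"
          by (rule hat_family_component[OF cp hat[OF N]])
        \<comment> \<open>Here the range of summation \<open>Suc N - (Nk + 1)\<close> is zero, so
          all poles have been integrated away.\<close>
        have "j.polar_part (Nk + 1) z = 0" for z using le by (simp add: j.polar_part_def)
        with expansion[of i] show ?thesis by simp
      qed
      then show "eq_mod_reg ?P (lam j) (\<Psi>hat k 0)
            (\<lambda>z. c j k *s (branch_ln \<eta> (z - lam j) *s \<Psi>hat j (int N - int Nk) z))"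
        by (simp add: eq_mod_reg_iff_components mult.assoc)
    next
      assume le: "Nk + 1 \<le> N"
      \<comment> \<open>The upper summation bound in \<open>polar_poly\<close>; the pole has order
        \<open>Suc m\<close>.\<close>
      define m where "m = N - Nk - 1"
      have m: "N - Nk = Suc m" "N - (Nk + 1) = m" "Suc N - (Nk + 1) = Suc m" "N - Nk - 1 = m"
        using le by (auto simp: m_def)
      have "eq_mod_analytic ?P (lam j) (\<lambda>z. \<Psi>hat k 0 z $ i)
          (\<lambda>z. c j k * (?L z * \<Psi>hat j (int N - int Nk) z $ i
             + 1 / (z - lam j) ^ (N - Nk) * polar_poly lam F j N Nk z $ i))" for i
      proof -
        interpret j: hat_family ?P "lam j" N "\<lambda>l. F l $ i $ j" "\<lambda>m z. \<Psi>hat j m z $ i"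
          by (rule hat_family_component[OF cp hat[OF N]])
        have polar: "j.polar_part (Nk + 1) z = 1 / (z - lam j) ^ (N - Nk) * polar_poly lam F j N Nk z $ i"
          if "z \<noteq> lam j" for z
        proof -
          have "fact (m - l) * F l $ i $ j / (z - lam j) ^ (Suc m - l)
              = 1 / (z - lam j) ^ Suc m * (fact (m - l) * (z - lam j) ^ l * F l $ i $ j)"
            if "l < Suc m" for l
            using that \<open>z \<noteq> lam j\<close> by (simp add: power_diff field_simps)
          then have "(\<Sum>l<Suc m. fact (m - l) * F l $ i $ j / (z - lam j) ^ (Suc m - l))
              = 1 / (z - lam j) ^ Suc m * (\<Sum>l=0..m. fact (m - l) * (z - lam j) ^ l * F l $ i $ j)"
            unfolding sum_distrib_left by (intro sum.cong) auto
          then show ?thesis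
            unfolding j.polar_part_def polar_poly_def m by (simp add: column_def)
        qed
        have "\<forall>\<^sub>F z in at (lam j) within ?P.
            c j k * (?L z * \<Psi>hat j (int N + 1 - int (Nk + 1)) z $ i + j.polar_part (Nk + 1) z)
            = c j k * (?L z * \<Psi>hat j (int N - int Nk) z $ i
             + 1 / (z - lam j) ^ (N - Nk) * polar_poly lam F j N Nk z $ i)"
          using eventually_domain
        proof eventually_elim
          case (elim z)
          then show ?case using polar[of z] by simp
        qed
        from eq_mod_analytic_trans[OF expansion eq_mod_analyticI[OF this]] show ?thesis .
      qed
      then show "eq_mod_reg ?P (lam j) (\<Psi>hat k 0)
            (\<lambda>z. c j k *s
               (branch_ln \<eta> (z - lam j) *s \<Psi>hat j (int N - int Nk) z
                + (1 / (z - lam j) ^ (N - Nk)) *s polar_poly lam F j N Nk z))"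
        by (simp add: eq_mod_reg_iff_components mult.assoc distrib_left)
    }
  qed
qed

end
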